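(* Let $X$ be a graphite. Then $\mathcal{T}(X)$ contains a dense $G_\delta$ subset of $\mathcal{C}(X)$.
   Context: For a compact metric space $(X,d)$, $\mathcal{C}(X)$ is the space of all continuous maps $f:X\to X$ with the metric $\rho(f,g)=\max_{x\in X}d(f(x),g(x))$. For a continuous map $f:X\to X$ and $\delta>0$, a $\delta$-pseudo-orbit for $f$ is a sequence $\langle x_i\rangle_{i\in\omega}$ in $X$ with $d(x_{i+1},f(x_i))<\delta$ for all $i\in\omega$. The map $f$ has shadowing if for every $\epsilon>0$ there exists $\delta>0$ such that for each $\delta$-pseudo-orbit $\langle x_i\rangle_{i\in\omega}$ for $f$ there exists $z\in X$ with $d(x_i,f^i(z))<\epsilon$ for all $i\in\omega$. $\mathcal{T}(X)$ is the subset of $\mathcal{C}(X)$ consisting of the maps with shadowing. A graph is a compact connected metric space $G$ for which there is a finite collection of arcs $A_1,\dots,A_n$ with $G=\bigcup_i A_i$ such that for $i\ne j$, $A_i\cap A_j$ is a subset of the endpoints of $A_i$ (and also of $A_j$). A graphoid is a compact metric space $X$ such that for every $\epsilon>0$ there exist a graph $G\subseteq X$ and a (continuous) retraction $\pi_G:X\to G$ that is an $\epsilon$-map, i.e. $\pi_G^{-1}(x)$ has diameter less than $\epsilon$ for each $x\in G$. A graphite is a locally connected graphoid. *)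

theory Defs
  imports "HOL-Analysis.Analysis"
begin

text \<open>
  A compact metric space is given as a compact subset \<open>X\<close> of a type of class \<open>metric_space\<close>,
  with the restricted metric.
\<close>

text \<open>
  The library's \<open>cfunspace\<close> is the metric space of bounded continuous maps with the supremum
  metric.  Its points are extensional on \<open>X\<close>, so each continuous map from \<open>X\<close> to \<open>X\<close> is
  represented exactly once; for compact \<open>X\<close> boundedness is automatic and the supremum is a maximum.
\<close>

definition cmaps :: "'a::metric_space set \<Rightarrow> ('a \<Rightarrow> 'a) metric" where
  "cmaps X = cfunspace (top_of_set X) (submetric euclidean_metric X)"

definition pseudo_orbit :: "'a::metric_space set \<Rightarrow> ('a \<Rightarrow> 'a) \<Rightarrow> real \<Rightarrow> (nat \<Rightarrow> 'a) \<Rightarrow> bool" where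
  "pseudo_orbit X f \<delta> x \<longleftrightarrow> (\<forall>i. x i \<in> X) \<and> (\<forall>i. dist (x (Suc i)) (f (x i)) < \<delta>)"

definition has_shadowing :: "'a::metric_space set \<Rightarrow> ('a \<Rightarrow> 'a) \<Rightarrow> bool" where
  "has_shadowing X f \<longleftrightarrow>
     (\<forall>\<epsilon>>0. \<exists>\<delta>>0. \<forall>x. pseudo_orbit X f \<delta> x \<longrightarrow>
        (\<exists>z\<in>X. \<forall>i. dist (x i) ((f ^^ i) z) < \<epsilon>))"

definition shadowing_maps :: "'a::metric_space set \<Rightarrow> ('a \<Rightarrow> 'a) set" where
  "shadowing_maps X = {f \<in> mspace (cmaps X). has_shadowing X f}"

text \<open>
  Each arc \<open>A\<^sub>i\<close> is the image of an injective path \<open>\<gamma> i\<close>.  Since the condition ranges over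
  ordered pairs, an intersection consists of endpoints of both arcs.  The number of arcs may
  be \<open>0\<close>, which only adds the empty space.
\<close>

definition is_graph :: "'a::metric_space set \<Rightarrow> bool" where
  "is_graph G \<longleftrightarrow> compact G \<and> connected G \<and>
     (\<exists>(n::nat) \<gamma> :: nat \<Rightarrow> real \<Rightarrow> 'a.
        (\<forall>i<n. arc (\<gamma> i)) \<and> G = (\<Union>i<n. path_image (\<gamma> i)) \<and>
        (\<forall>i<n. \<forall>j<n. i \<noteq> j \<longrightarrow>
           path_image (\<gamma> i) \<inter> path_image (\<gamma> j) \<subseteq> {pathstart (\<gamma> i), pathfinish (\<gamma> i)}))"

definition is_graphoid :: "'a::metric_space set \<Rightarrow> bool" where
  "is_graphoid X \<longleftrightarrow> compact X \<and>
     (\<forall>\<epsilon>>0. \<exists>G r. is_graph G \<and> G \<subseteq> X \<and> retraction X G r \<and>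
        (\<forall>x\<in>G. diameter {y \<in> X. r y = x} < \<epsilon>))"

definition is_graphite :: "'a::metric_space set \<Rightarrow> bool" where
  "is_graphite X \<longleftrightarrow> is_graphoid X \<and> locally connected X"

end

theory Submission
  imports Defs
begin

text \<open>
  The maps having a \<open>\<delta>\<close> for one fixed \<open>\<epsilon>\<close> are shown to contain a dense open set.  Intersecting these
  open sets over \<open>\<epsilon> = 1/(n+1)\<close> and applying the Baire category theorem to the complete space of
  continuous self-maps gives the dense \<open>G\<^sub>\<delta>\<close>.  So, given \<open>f\<close> and \<open>\<epsilon>\<close>, one needs a map \<open>g\<close> near \<open>f\<close>
  such that every continuous \<open>F\<close> close enough to \<open>g\<close> \<open>\<epsilon>\<close>-shadows its pseudo-orbits
  (\<open>robust_shadowing_dense\<close>).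

  Choose a graph \<open>G\<close> in \<open>X\<close> with a retraction \<open>r\<close> that moves points very little, and cut \<open>G\<close> into short
  arcs, called tiles, which meet only at endpoints (\<open>graph_fine_tiling\<close>).  The map \<open>g\<close> is \<open>\<phi> \<circ> r\<close>, where
  \<open>\<phi>\<close> is a map of \<open>G\<close> that is Markov for the tiling (\<open>markov_map_along\<close>): it carries each tile along a
  finite walk of whole tiles, all of them close to the image of the tile under \<open>r \<circ> f\<close>.  Such a walk
  exists because that image is connected, so the tiles meeting it form a connected chain
  (\<open>tile_walk_along_connected\<close>).  In addition \<open>\<phi>\<close> is constant on the outer thirds of every tile.

  The two features of \<open>\<phi>\<close> survive small perturbations, and each yields one half of shadowing.  Being
  constant near the vertices, \<open>\<phi>\<close> sends a whole neighbourhood of a tile into the tiles of its walk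
  (\<open>markov_map_near_tile\<close>).  Hence a pseudo-orbit of a perturbation follows an admissible itinerary of
  tiles, every tile being on the walk of its predecessor.  Conversely, the middle third of a tile is
  stretched fully across every tile of its walk, and a small perturbation still stretches it across
  the middle third of that tile (\<open>robust_crossing\<close>).  Hence every admissible itinerary is realised by
  a true orbit: pulling back the middle thirds gives nested compact intervals, and a common point
  starts an orbit that visits the prescribed tiles (\<open>markov_map_shadowing\<close>).

  A perturbation \<open>F\<close> maps \<open>G\<close> into \<open>X\<close> rather than into \<open>G\<close>.  The pullback is therefore carried out on
  parameter intervals of a single arc, with only \<open>r \<circ> F\<^sup>n\<close> compared with the tiles, and never needs
  an \<open>F\<close>-invariant graph.
\<close>

section \<open>Intervals and compact sets\<close>

text \<open>
  Take the first point after \<open>u\<close> where the value is \<open>q\<close>, and then the last point before it where the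
  value is \<open>p\<close>.  In between the values cannot leave \<open>{p..q}\<close>.
\<close>

lemma interval_onto_subinterval:
  fixes s :: "real \<Rightarrow> real"
  assumes cont: "continuous_on {a..b} s" and "p \<le> q"
    and u: "u \<in> {a..b}" "s u \<le> p" and v: "v \<in> {a..b}" "q \<le> s v"
  obtains a' b' where "a' \<le> b'" "{a'..b'} \<subseteq> {a..b}" "s ` {a'..b'} = {p..q}"
proof -
  have main: "\<exists>a' b'. a' \<le> b' \<and> {a'..b'} \<subseteq> {u..v} \<and> s ` {a'..b'} = {p..q}"
    if "u \<le> v" "continuous_on {u..v} s" "s u \<le> p" "q \<le> s v" "p \<le> q" for s :: "real \<Rightarrow> real" and u v p q
  proof -
    \<comment> \<open>first hitting point of \<open>q\<close>\<close>
    define B where "B = {t \<in> {u..v}. s t = q}"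
    have "compact B"
    proof -
      have "B = {u..v} \<inter> s -` {q}" by (auto simp: B_def)
      then have "closed B" using continuous_closed_preimage[OF that(2), of "{q}"] by simp
      moreover have "B \<subseteq> {u..v}" by (auto simp: B_def)
      ultimately show ?thesis
        using bounded_subset[OF compact_imp_bounded[OF compact_Icc]] by (simp add: compact_eq_bounded_closed)
    qed
    moreover have "B \<noteq> {}"
      using IVT'[of s u q v] that by (auto simp: B_def)
    ultimately obtain b' where b': "b' \<in> B" "\<And>t. t \<in> B \<Longrightarrow> b' \<le> t"
      using compact_attains_inf[of B] by metis
    have b'uv: "u \<le> b'" "b' \<le> v" "s b' = q" using b' by (auto simp: B_def)
    have contb: "continuous_on {u..b'} s"
      using that(2) b'uv by (auto intro: continuous_on_subset)
    have le_q: "s t \<le> q" if t: "t \<in> {u..b'}" for t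
    proof (rule ccontr)
      assume "\<not> s t \<le> q"
      moreover have "continuous_on {u..t} s"
        using contb t by (auto intro: continuous_on_subset)
      ultimately obtain c where "u \<le> c" "c \<le> t" "s c = q"
        using IVT'[of s u q t] t \<open>p \<le> q\<close> \<open>s u \<le> p\<close> by auto
      then have "c \<in> B" using t b'uv by (auto simp: B_def)
      then have "t = c" using b'(2)[of c] t \<open>c \<le> t\<close> by auto
      with \<open>s c = q\<close> \<open>\<not> s t \<le> q\<close> show False by simp
    qed
    \<comment> \<open>last point before \<open>b'\<close> with value \<open>p\<close>\<close>
    define A where "A = {t \<in> {u..b'}. s t = p}"
    have "compact A"
    proof -
      have "A = {u..b'} \<inter> s -` {p}" by (auto simp: A_def)
      then have "closed A" using continuous_closed_preimage[OF contb, of "{p}"] by simp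
      moreover have "A \<subseteq> {u..b'}" by (auto simp: A_def)
      ultimately show ?thesis
        using bounded_subset[OF compact_imp_bounded[OF compact_Icc]] by (simp add: compact_eq_bounded_closed)
    qed
    moreover have "A \<noteq> {}"
      using IVT'[of s u p b'] contb b'uv that by (auto simp: A_def)
    ultimately obtain a' where a': "a' \<in> A" "\<And>t. t \<in> A \<Longrightarrow> t \<le> a'"
      using compact_attains_sup[of A] by metis
    have a'ub: "u \<le> a'" "a' \<le> b'" "s a' = p" using a' by (auto simp: A_def)
    have conta: "continuous_on {a'..b'} s"
      using contb a'ub by (auto intro: continuous_on_subset)
    have ge_p: "p \<le> s t" if t: "t \<in> {a'..b'}" for t
    proof (rule ccontr)
      assume "\<not> p \<le> s t"
      moreover have "continuous_on {t..b'} s"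
        using conta t by (auto intro: continuous_on_subset)
      ultimately obtain c where "t \<le> c" "c \<le> b'" "s c = p"
        using IVT'[of s t p b'] t b'uv \<open>p \<le> q\<close> by auto
      then have "c \<in> A" using t a'ub by (auto simp: A_def)
      then have "t = c" using a'(2)[of c] t \<open>t \<le> c\<close> by auto
      with \<open>s c = p\<close> \<open>\<not> p \<le> s t\<close> show False by simp
    qed
    have "s ` {a'..b'} = {p..q}"
    proof
      show "s ` {a'..b'} \<subseteq> {p..q}" using le_q ge_p a'ub by auto
      show "{p..q} \<subseteq> s ` {a'..b'}"
      proof
        fix y assume "y \<in> {p..q}"
        then obtain c where "a' \<le> c" "c \<le> b'" "s c = y"
          using IVT'[of s a' y b'] conta a'ub b'uv by auto
        then show "y \<in> s ` {a'..b'}" by auto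
      qed
    qed
    then show ?thesis using a'ub b'uv by (intro exI[of _ a'] exI[of _ b']) auto
  qed
  show thesis
  proof (cases "u \<le> v")
    case True
    have "continuous_on {u..v} s" using cont u v by (auto intro: continuous_on_subset)
    from main[OF True this u(2) v(2) \<open>p \<le> q\<close>] obtain a' b' where
      "a' \<le> b'" "{a'..b'} \<subseteq> {u..v}" "s ` {a'..b'} = {p..q}" by blast
    then show thesis using that[of a' b'] u v by auto
  next
    case False
    then have "v \<le> u" by simp
    have "continuous_on {v..u} (\<lambda>t. - s t)"
      using cont u v by (intro continuous_intros) (auto intro: continuous_on_subset)
    from main[OF \<open>v \<le> u\<close> this, of "-q" "-p"] obtain a' b' where
      ab: "a' \<le> b'" "{a'..b'} \<subseteq> {v..u}" and im: "(\<lambda>t. - s t) ` {a'..b'} = {-q..-p}"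
      using u v \<open>p \<le> q\<close> by auto
    have "s ` {a'..b'} = uminus ` ((\<lambda>t. - s t) ` {a'..b'})"
      by (simp add: image_image)
    also have "\<dots> = {p..q}" unfolding im by simp
    finally show thesis
      using that[OF ab(1)] ab(2) u v by auto
  qed
qed

lemma compact_disjoint_dist:
  fixes S T :: "'a::metric_space set"
  assumes "compact S" "compact T" "S \<inter> T = {}"
  obtains \<eta> where "\<eta> > 0" "\<And>x y. x \<in> S \<Longrightarrow> y \<in> T \<Longrightarrow> \<eta> \<le> dist x y"
proof (cases "S = {} \<or> T = {}")
  case True
  then show thesis using that[of 1] by auto
next
  case False
  have "continuous_on (S \<times> T) (\<lambda>z. dist (fst z) (snd z))"
    by (intro continuous_intros)
  moreover have "compact (S \<times> T)" "S \<times> T \<noteq> {}"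
    using assms compact_Times False by auto
  ultimately obtain z where z: "z \<in> S \<times> T" "\<forall>w\<in>S \<times> T. dist (fst z) (snd z) \<le> dist (fst w) (snd w)"
    using continuous_attains_inf by meson
  have "dist (fst z) (snd z) > 0" using z(1) assms(3) by auto
  then show thesis using that[of "dist (fst z) (snd z)"] z(2) by force
qed

lemma finite_uniform_radius:
  assumes "finite I" "\<And>i. i \<in> I \<Longrightarrow> \<exists>\<eta>>0::real. P i \<eta>"
    "\<And>i \<eta> \<eta>'. \<lbrakk>i \<in> I; P i \<eta>; 0 < \<eta>'; \<eta>' \<le> \<eta>\<rbrakk> \<Longrightarrow> P i \<eta>'"
  shows "\<exists>\<eta>>0. \<forall>i\<in>I. P i \<eta>"
  using assms
proof (induction I rule: finite_induct)
  case empty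
  then show ?case by (intro exI[of _ 1]) simp
next
  case (insert i I)
  obtain \<eta>1 where 1: "\<eta>1 > 0" "P i \<eta>1" using insert.prems(1) by blast
  have "\<exists>\<eta>>0. \<forall>i\<in>I. P i \<eta>"
  proof (rule insert.IH)
    show "\<exists>\<eta>>0. P j \<eta>" if "j \<in> I" for j using insert.prems(1) that by blast
    show "P j \<eta>'" if "j \<in> I" "P j \<eta>" "0 < \<eta>'" "\<eta>' \<le> \<eta>" for j \<eta> \<eta>'
      using insert.prems(2)[of j \<eta> \<eta>'] that by blast
  qed
  then obtain \<eta>2 where 2: "\<eta>2 > 0" "\<forall>i\<in>I. P i \<eta>2" by blast
  have "P j (min \<eta>1 \<eta>2)" if "j \<in> insert i I" for j
  proof (cases "j = i")
    case True
    then show ?thesis using insert.prems(2)[of i \<eta>1 "min \<eta>1 \<eta>2"] 1 2 by simp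
  next
    case False
    then show ?thesis using insert.prems(2)[of j \<eta>2 "min \<eta>1 \<eta>2"] 1 2 that by simp
  qed
  then show ?case using 1 2 by (intro exI[of _ "min \<eta>1 \<eta>2"]) simp
qed

section \<open>Tilings of a graph by short arcs\<close>

text \<open>
  Each unordered pair of tiles is covered twice by the last condition, so a common point of two tiles
  is an endpoint of both.
\<close>

locale arc_tiling =
  fixes I :: "'i set" and \<gamma> :: "'i \<Rightarrow> real \<Rightarrow> 'a::metric_space" and G :: "'a set"
  assumes finite_tiles: "finite I"
    and arc_tile: "i \<in> I \<Longrightarrow> arc (\<gamma> i)"
    and tiles_cover: "G = (\<Union>i\<in>I. path_image (\<gamma> i))"
    and tiles_meet: "\<lbrakk>i \<in> I; j \<in> I; i \<noteq> j\<rbrakk>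
      \<Longrightarrow> path_image (\<gamma> i) \<inter> path_image (\<gamma> j) \<subseteq> {pathstart (\<gamma> i), pathfinish (\<gamma> i)}"
begin

abbreviation tile :: "'i \<Rightarrow> 'a set" where
  "tile i \<equiv> path_image (\<gamma> i)"

lemma tile_inj: "\<lbrakk>i \<in> I; s \<in> {0..1}; t \<in> {0..1}; \<gamma> i s = \<gamma> i t\<rbrakk> \<Longrightarrow> s = t"
  using arc_tile[of i] by (auto simp: arc_def inj_on_def)

lemma tile_cont: "i \<in> I \<Longrightarrow> continuous_on {0..1} (\<gamma> i)"
  using arc_tile[of i] by (auto simp: arc_def path_def)

lemma tile_compact: "i \<in> I \<Longrightarrow> compact (tile i)"
  using arc_tile[of i] by (simp add: arc_def compact_path_image)

lemma tile_subset: "i \<in> I \<Longrightarrow> tile i \<subseteq> G"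
  using tiles_cover by auto

lemma in_tile: "t \<in> {0..1} \<Longrightarrow> \<gamma> i t \<in> tile i"
  by (auto simp: path_image_def)

lemma other_tile_endpoint:
  assumes "i \<in> I" "k \<in> I" "i \<noteq> k" "t \<in> {0..1}" "\<gamma> k t \<in> tile i"
  shows "t = 0 \<or> t = 1"
proof -
  have "\<gamma> k t \<in> {\<gamma> k 0, \<gamma> k 1}"
    using tiles_meet[of k i] assms in_tile[of t k] by (auto simp: pathstart_def pathfinish_def)
  then consider "\<gamma> k t = \<gamma> k 0" | "\<gamma> k t = \<gamma> k 1" by blast
  then show ?thesis
    by cases (use tile_inj[OF assms(2,4)] in auto)
qed

lemma tile_inverse:
  assumes "i \<in> I"
  obtains q where "continuous_on (tile i) q" "\<And>t. t \<in> {0..1} \<Longrightarrow> q (\<gamma> i t) = t"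
    "\<And>y. y \<in> tile i \<Longrightarrow> q y \<in> {0..1} \<and> \<gamma> i (q y) = y"
proof -
  obtain q where q: "homeomorphism {0..1} (tile i) (\<gamma> i) q"
    using homeomorphism_arc[OF arc_tile[OF assms]] .
  show thesis
  proof (rule that)
    show "continuous_on (tile i) q" using q by (simp add: homeomorphism_def)
    show "\<And>t. t \<in> {0..1} \<Longrightarrow> q (\<gamma> i t) = t" using q by (simp add: homeomorphism_def)
    show "\<And>y. y \<in> tile i \<Longrightarrow> q y \<in> {0..1} \<and> \<gamma> i (q y) = y"
      using q by (metis homeomorphism_def image_eqI)
  qed
qed

end

text \<open>
  Every arc of the graph is divided into \<open>m\<close> subarcs of equal parameter length, with \<open>1 / m\<close> below a
  common modulus of uniform continuity.  A point shared by pieces of different arcs is an endpoint of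
  these arcs, hence has parameter \<open>0\<close> or \<open>1\<close>, which are subdivision points.
\<close>

lemma graph_fine_tiling:
  fixes G :: "'a::metric_space set"
  assumes "is_graph G" "h > 0"
  obtains I :: "(nat \<times> nat) set" and \<gamma> where "arc_tiling I \<gamma> G"
    "\<And>i x y. \<lbrakk>i \<in> I; x \<in> path_image (\<gamma> i); y \<in> path_image (\<gamma> i)\<rbrakk> \<Longrightarrow> dist x y < h"
proof -
  obtain n :: nat and \<alpha> :: "nat \<Rightarrow> real \<Rightarrow> 'a" where
    arcs: "\<And>i. i < n \<Longrightarrow> arc (\<alpha> i)" and G: "G = (\<Union>i<n. path_image (\<alpha> i))" and
    meet: "\<And>i j. i < n \<Longrightarrow> j < n \<Longrightarrow> i \<noteq> j \<Longrightarrow>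
      path_image (\<alpha> i) \<inter> path_image (\<alpha> j) \<subseteq> {pathstart (\<alpha> i), pathfinish (\<alpha> i)}"
    using assms(1) unfolding is_graph_def by blast
  have inj: "s = t" if "i < n" "s \<in> {0..1}" "t \<in> {0..1}" "\<alpha> i s = \<alpha> i t" for i s t
    using arcs[OF that(1)] that by (auto simp: arc_def inj_on_def)
  have "\<exists>d>0. \<forall>s\<in>{0..1}. \<forall>t\<in>{0..1}. dist s t < d \<longrightarrow> dist (\<alpha> i s) (\<alpha> i t) < h"
    if "i \<in> {..<n}" for i
  proof -
    have "uniformly_continuous_on {0..1} (\<alpha> i)"
      using arcs[of i] that by (intro compact_uniformly_continuous) (auto simp: arc_def path_def)
    then obtain d where "d > 0"
      "\<forall>x\<in>{0..1}. \<forall>x'\<in>{0..1}. dist x' x < d \<longrightarrow> dist (\<alpha> i x') (\<alpha> i x) < h"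
      using assms(2) unfolding uniformly_continuous_on_def by blast
    then show ?thesis by (intro exI[of _ d]) auto
  qed
  then have "\<exists>c>0. \<forall>i\<in>{..<n}. \<forall>s\<in>{0..1}. \<forall>t\<in>{0..1}.
      dist s t < c \<longrightarrow> dist (\<alpha> i s) (\<alpha> i t) < h"
    by (rule finite_uniform_radius[OF finite_lessThan]) (assumption, meson order.strict_trans2)
  then obtain c where c: "c > 0"
    "\<And>i s t. \<lbrakk>i < n; s \<in> {0..1}; t \<in> {0..1}; dist s t < c\<rbrakk> \<Longrightarrow> dist (\<alpha> i s) (\<alpha> i t) < h"
    by blast
  obtain m :: nat where m: "m > 0" "1 / real m < c"
    using real_arch_invD[OF c(1)] by (auto simp: inverse_eq_divide)
  define I where "I = {..<n} \<times> {..<m}"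
  define \<gamma> where "\<gamma> = (\<lambda>(i,k) t. \<alpha> i ((real k + t) / m))"
  have img: "path_image (\<gamma> (i,k)) = \<alpha> i ` {real k / m..(real k + 1) / m}" for i k
  proof -
    have "(\<lambda>t. (real k + t) / m) ` {0..1} = {real k / m..(real k + 1) / m}"
    proof
      show "(\<lambda>t. (real k + t) / m) ` {0..1} \<subseteq> {real k / m..(real k + 1) / m}"
        using m(1) by (auto simp: divide_right_mono)
      show "{real k / m..(real k + 1) / m} \<subseteq> (\<lambda>t. (real k + t) / m) ` {0..1}"
      proof
        fix u assume "u \<in> {real k / m..(real k + 1) / m}"
        then show "u \<in> (\<lambda>t. (real k + t) / m) ` {0..1}"
          using m(1) by (intro image_eqI[of _ _ "u * m - k"]) (auto simp: field_simps)
      qed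
    qed
    moreover have "path_image (\<gamma> (i,k)) = \<alpha> i ` ((\<lambda>t. (real k + t) / m) ` {0..1})"
      by (simp add: \<gamma>_def path_image_def image_image)
    ultimately show ?thesis by simp
  qed
  have ends: "pathstart (\<gamma> (i,k)) = \<alpha> i (real k / m)" "pathfinish (\<gamma> (i,k)) = \<alpha> i ((real k + 1) / m)" for i k
    by (auto simp: \<gamma>_def pathstart_def pathfinish_def)
  have range: "0 \<le> real k / m" "real k / m \<le> 1" "0 \<le> (real k + 1) / m" "(real k + 1) / m \<le> 1"
     "real k / m < (real k + 1) / m" if "k < m" for k
    using that m(1) by (auto simp: field_simps)
  have sub01: "t \<in> {0..1}" if k: "k < m" and t: "t \<in> {real k / m..(real k + 1) / m}" for k t
  proof -
    have "0 \<le> t" using order_trans[OF range(1)[OF k], of t] t by simp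
    moreover have "t \<le> 1" using order_trans[OF _ range(4)[OF k], of t] t by simp
    ultimately show ?thesis by simp
  qed
  show thesis
  proof (rule that)
    show "arc_tiling I \<gamma> G"
    proof
      show "finite I" by (simp add: I_def)
    next
      fix i assume "i \<in> I"
      then obtain j k where jk: "i = (j,k)" "j < n" "k < m" by (auto simp: I_def)
      have into: "(real k + t) / m \<in> {0..1}" if "t \<in> {0..1}" for t
        using that jk(3) by (auto simp: field_simps)
      have "path (\<gamma> i)"
        unfolding path_def jk \<gamma>_def prod.case
      proof (rule continuous_on_compose2[where f = "\<lambda>t. (real k + t) / m" and t = "{0..1}"])
        show "continuous_on {0..1} (\<alpha> j)" using arcs[OF jk(2)] by (simp add: arc_def path_def)
        show "continuous_on {0..1} (\<lambda>t. (real k + t) / m)" by (intro continuous_intros) (use m in auto)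
      qed (use into in auto)
      moreover have "inj_on (\<gamma> i) {0..1}"
      proof (rule inj_onI)
        fix s t assume st: "s \<in> {0..1}" "t \<in> {0..1}" "\<gamma> i s = \<gamma> i t"
        then have "(real k + s) / m = (real k + t) / m"
          using inj[OF jk(2) into into] by (simp add: jk \<gamma>_def)
        then show "s = t" using m(1) by simp
      qed
      ultimately show "arc (\<gamma> i)" by (simp add: arc_def)
    next
      have union: "(\<Union>k<m. {real k / m..(real k + 1) / m}) = {0..1}"
      proof
        show "(\<Union>k<m. {real k / m..(real k + 1) / m}) \<subseteq> {0..1}"
          using sub01 by blast
        show "{0..1} \<subseteq> (\<Union>k<m. {real k / m..(real k + 1) / m})"
        proof
          fix t :: real assume t: "t \<in> {0..1}"
          show "t \<in> (\<Union>k<m. {real k / m..(real k + 1) / m})"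
          proof (cases "t = 1")
            case True
            then show ?thesis using m(1) by (intro UN_I[of "m-1"]) (auto simp: of_nat_diff)
          next
            case False
            define k where "k = nat \<lfloor>t * m\<rfloor>"
            have "real k \<le> t * m" "t * m < real k + 1" using t by (auto simp: k_def)
            moreover have "t * m < m" using t False m(1) by auto
            ultimately have "real k < real m" by linarith
            then have "k < m" by simp
            moreover have "real k / m \<le> t" "t \<le> (real k + 1) / m"
              using m(1) \<open>real k \<le> t * m\<close> \<open>t * m < real k + 1\<close> by (simp_all add: field_simps)
            ultimately show ?thesis by auto
          qed
        qed
      qed
      have "(\<Union>i\<in>I. path_image (\<gamma> i)) = (\<Union>j<n. \<Union>k<m. path_image (\<gamma> (j,k)))"
        unfolding I_def by blast
      also have "\<dots> = (\<Union>j<n. \<alpha> j ` (\<Union>k<m. {real k / m..(real k + 1) / m}))"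
        unfolding img image_UN ..
      finally have "(\<Union>i\<in>I. path_image (\<gamma> i)) = \<dots>" .
      then show "G = (\<Union>i\<in>I. path_image (\<gamma> i))" unfolding union G by (simp add: path_image_def)
    next
      fix i i' assume "i \<in> I" "i' \<in> I" "i \<noteq> i'"
      then obtain j k j' k' where i: "i = (j,k)" "j < n" "k < m" "i' = (j',k')" "j' < n" "k' < m"
        "j \<noteq> j' \<or> k \<noteq> k'" by (auto simp: I_def)
      show "path_image (\<gamma> i) \<inter> path_image (\<gamma> i') \<subseteq> {pathstart (\<gamma> i), pathfinish (\<gamma> i)}"
      proof
        fix y assume "y \<in> path_image (\<gamma> i) \<inter> path_image (\<gamma> i')"
        then obtain s s' where s: "y = \<alpha> j s" "s \<in> {real k / m..(real k + 1) / m}"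
          "y = \<alpha> j' s'" "s' \<in> {real k' / m..(real k' + 1) / m}" unfolding i img by blast
        have s01: "s \<in> {0..1}" "s' \<in> {0..1}" using s sub01[OF i(3)] sub01[OF i(6)] by blast+
        have "s = real k / m \<or> s = (real k + 1) / m"
        proof (cases "j = j'")
          case True
          then have "s' = s" using s inj[OF i(2) s01] by simp
          consider "k + 1 \<le> k'" | "k' + 1 \<le> k" using True i(7) by linarith
          then show ?thesis
          proof cases
            case 1
            then have "(real k + 1) / m \<le> real k' / m" using m(1) by (simp add: divide_right_mono)
            then show ?thesis using s \<open>s' = s\<close> by auto
          next
            case 2
            then have "(real k' + 1) / m \<le> real k / m" using m(1) by (simp add: divide_right_mono)
            then show ?thesis using s \<open>s' = s\<close> by auto
          qed
        next
          case False
          moreover have "\<alpha> j s \<in> path_image (\<alpha> j)" "\<alpha> j s \<in> path_image (\<alpha> j')"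
            using s(1,3) s01 unfolding path_image_def by blast+
          ultimately have "\<alpha> j s \<in> {\<alpha> j 0, \<alpha> j 1}"
            using meet[OF i(2,5)] unfolding pathstart_def pathfinish_def by blast
          then have "\<alpha> j s = \<alpha> j 0 \<or> \<alpha> j s = \<alpha> j 1" by blast
          then have "s = 0 \<or> s = 1" using inj[OF i(2) s01(1), of 0] inj[OF i(2) s01(1), of 1] by auto
          moreover have "real k / m \<ge> 0" "(real k + 1) / m \<le> 1"
            "real k / m \<le> s" "s \<le> (real k + 1) / m" using range[OF i(3)] s(2) by auto
          ultimately show ?thesis by linarith
        qed
        then show "y \<in> {pathstart (\<gamma> i), pathfinish (\<gamma> i)}" unfolding i ends using s(1) by blast
      qed
    qed
  next
    fix i x y assume *: "i \<in> I" "x \<in> path_image (\<gamma> i)" "y \<in> path_image (\<gamma> i)"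
    then obtain j k where jk: "i = (j,k)" "j < n" "k < m" by (auto simp: I_def)
    obtain s t where st: "x = \<alpha> j s" "y = \<alpha> j t" "s \<in> {real k / m..(real k + 1) / m}"
       "t \<in> {real k / m..(real k + 1) / m}" using *(2,3) unfolding jk img by blast
    have "dist s t \<le> 1 / m" using st by (auto simp: dist_real_def add_divide_distrib)
    then have "dist s t < c" using m(2) by linarith
    then show "dist x y < h" unfolding st using c(2)[OF jk(2)] sub01[OF jk(3)] st by blast
  qed
qed

section \<open>Walks along tiles\<close>

context arc_tiling
begin

text \<open>
  The tile \<open>e\<close> may be run through in either direction, so \<open>a < b\<close> is not required.  The parametrization
  is affine, which makes the property stable under concatenation of paths.
\<close>

definition traverses :: "(real \<Rightarrow> 'a) \<Rightarrow> 'i \<Rightarrow> bool" where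
  "traverses p e \<longleftrightarrow>
     (\<exists>a\<in>{0..1}. \<exists>b\<in>{0..1}. a \<noteq> b \<and> (\<forall>s\<in>{0..1}. p (a + s * (b - a)) = \<gamma> e s))"

definition tile_walk :: "'i set \<Rightarrow> (real \<Rightarrow> 'a) \<Rightarrow> bool" where
  "tile_walk S p \<longleftrightarrow>
     path p \<and> path_image p \<subseteq> (\<Union>e\<in>S. tile e) \<and> (\<forall>e\<in>S. traverses p e)"

lemma between_01: "\<lbrakk>a \<in> {0..1}; b \<in> {0..1}; s \<in> {0..1}\<rbrakk> \<Longrightarrow> a + s * (b - a) \<in> {0..1::real}"
  using convexD_alt[OF convex_real_interval(5)[of 0 1], of a b s] by (simp add: algebra_simps)

lemma traverses_join1:
  assumes "traverses p e"
  shows "traverses (p +++ q) e"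
proof -
  obtain a b where ab: "a \<in> {0..1}" "b \<in> {0..1}" "a \<noteq> b"
    and p: "\<And>s. s \<in> {0..1} \<Longrightarrow> p (a + s * (b - a)) = \<gamma> e s"
    using assms unfolding traverses_def by blast
  have half: "(p +++ q) (u / 2) = p u" if "u \<in> {0..1}" for u
    using that by (simp add: joinpaths_def)
  have "(p +++ q) (a / 2 + s * (b / 2 - a / 2)) = \<gamma> e s" if s: "s \<in> {0..1}" for s
  proof -
    have "a / 2 + s * (b / 2 - a / 2) = (a + s * (b - a)) / 2" by (simp add: field_simps)
    then show ?thesis using half[OF between_01[OF ab(1,2) s]] p[OF s] by metis
  qed
  moreover have "a / 2 \<in> {0..1}" "b / 2 \<in> {0..1}" "a / 2 \<noteq> b / 2" using ab by auto
  ultimately show ?thesis unfolding traverses_def by blast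
qed

lemma traverses_join2:
  assumes "traverses q e" "pathfinish p = pathstart q"
  shows "traverses (p +++ q) e"
proof -
  obtain a b where ab: "a \<in> {0..1}" "b \<in> {0..1}" "a \<noteq> b"
    and q: "\<And>s. s \<in> {0..1} \<Longrightarrow> q (a + s * (b - a)) = \<gamma> e s"
    using assms(1) unfolding traverses_def by blast
  have half: "(p +++ q) ((1 + u) / 2) = q u" if "u \<in> {0..1}" for u
  proof (cases "u = 0")
    case False
    then have "(p +++ q) ((1 + u) / 2) = q (2 * ((1 + u) / 2) - 1)"
      using that by (simp add: joinpaths_def)
    then show ?thesis by (simp add: field_simps)
  qed (use assms(2) in \<open>simp add: joinpaths_def pathfinish_def pathstart_def\<close>)
  have "(p +++ q) ((1 + a) / 2 + s * ((1 + b) / 2 - (1 + a) / 2)) = \<gamma> e s" if s: "s \<in> {0..1}" for s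
  proof -
    have "(1 + a) / 2 + s * ((1 + b) / 2 - (1 + a) / 2) = (1 + (a + s * (b - a))) / 2"
      by (simp add: field_simps)
    then show ?thesis using half[OF between_01[OF ab(1,2) s]] q[OF s] by metis
  qed
  moreover have "(1 + a) / 2 \<in> {0..1}" "(1 + b) / 2 \<in> {0..1}" "(1 + a) / 2 \<noteq> (1 + b) / 2" using ab by auto
  ultimately show ?thesis unfolding traverses_def by blast
qed

lemma tile_walk_join:
  assumes "tile_walk S p" "tile_walk T q" "pathfinish p = pathstart q"
  shows "tile_walk (S \<union> T) (p +++ q)"
  using assms unfolding tile_walk_def
  using traverses_join1[of p _ q] traverses_join2[of q _ p] by (simp add: path_image_join) blast

lemma tile_walk_forward: "e \<in> I \<Longrightarrow> tile_walk {e} (\<gamma> e)"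
  using arc_tile[of e] unfolding tile_walk_def traverses_def arc_def
  by simp (intro bexI[of _ "0::real"] bexI[of _ "1::real"]; simp)

lemma tile_walk_backward:
  assumes "e \<in> I"
  shows "tile_walk {e} (reversepath (\<gamma> e))"
proof -
  have "reversepath (\<gamma> e) (1 + s * (0 - 1)) = \<gamma> e s" for s
    by (simp add: reversepath_def)
  then have "traverses (reversepath (\<gamma> e)) e"
    unfolding traverses_def by (intro bexI[of _ 1] bexI[of _ 0]) auto
  then show ?thesis using arc_tile[OF assms] by (simp add: tile_walk_def arc_def)
qed

text \<open>
  A walk from an endpoint of a tile back to itself goes to the other end and returns; a constant path
  would not traverse the tile.
\<close>

lemma tile_walk_single:
  assumes e: "e \<in> I" and x: "x \<in> {\<gamma> e 0, \<gamma> e 1}" and y: "y \<in> {\<gamma> e 0, \<gamma> e 1}"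
  obtains p where "tile_walk {e} p" "pathstart p = x" "pathfinish p = y"
proof -
  have ends: "pathstart (\<gamma> e) = \<gamma> e 0" "pathfinish (\<gamma> e) = \<gamma> e 1"
    by (simp_all add: pathstart_def pathfinish_def)
  note fw = tile_walk_forward[OF e] and bw = tile_walk_backward[OF e]
  have fb: "tile_walk {e} (\<gamma> e +++ reversepath (\<gamma> e))"
    using tile_walk_join[OF fw bw] by simp
  have bf: "tile_walk {e} (reversepath (\<gamma> e) +++ \<gamma> e)"
    using tile_walk_join[OF bw fw] by simp
  show thesis
    using x y that[OF fw] that[OF bw] that[OF fb] that[OF bf] ends by auto
qed

text \<open>
  The tiles that can be reached from \<open>j\<close> by walks within the tiles meeting \<open>P\<close>, and the other tiles
  meeting \<open>P\<close>, cover \<open>P\<close> by two closed sets.  If both families were nonempty, connectedness would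
  give a point of \<open>P\<close> in a reachable and an unreachable tile.  It is a common vertex of the two, and
  the walk could be continued through it.
\<close>

lemma tile_walk_along_connected:
  assumes P: "connected P" "P \<subseteq> G"
    and j: "j \<in> I" "tile j \<inter> P \<noteq> {}" and k: "k \<in> I" "tile k \<inter> P \<noteq> {}"
  obtains S p where "S \<subseteq> {e \<in> I. tile e \<inter> P \<noteq> {}}" "tile_walk S p"
    "pathstart p = \<gamma> j 0" "pathfinish p = \<gamma> k 0"
proof -
  define W where "W = {e \<in> I. tile e \<inter> P \<noteq> {}}"
  define R where "R = {e \<in> W. \<exists>S p. S \<subseteq> W \<and> tile_walk S p \<and> pathstart p = \<gamma> j 0 \<and> pathfinish p = \<gamma> e 0}"
  have "W \<subseteq> I" "R \<subseteq> W" by (auto simp: W_def R_def)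
  have jW: "j \<in> W" "k \<in> W" using j k by (auto simp: W_def)
  obtain p where "tile_walk {j} p" "pathstart p = \<gamma> j 0" "pathfinish p = \<gamma> j 0"
    by (rule tile_walk_single[OF j(1), of "\<gamma> j 0" "\<gamma> j 0"]) auto
  then have jR: "j \<in> R" using jW unfolding R_def by blast
  have "W \<subseteq> R"
  proof (rule ccontr)
    assume "\<not> W \<subseteq> R"
    then obtain l where l: "l \<in> W" "l \<notin> R" by blast
    define A where "A = (\<Union>e\<in>R. tile e)"
    define B where "B = (\<Union>e\<in>W - R. tile e)"
    have "finite R" "finite (W - R)"
      using finite_tiles \<open>W \<subseteq> I\<close> \<open>R \<subseteq> W\<close> by (meson finite_Diff finite_subset)+
    then have "closed A" "closed B" unfolding A_def B_def
      using tile_compact \<open>W \<subseteq> I\<close> \<open>R \<subseteq> W\<close> by (auto intro!: closed_UN compact_imp_closed)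
    moreover have "P \<subseteq> A \<union> B"
    proof
      fix x assume "x \<in> P"
      then obtain e where "e \<in> I" "x \<in> tile e" using P(2) tiles_cover by blast
      then show "x \<in> A \<union> B" using \<open>x \<in> P\<close> by (auto simp: A_def B_def W_def)
    qed
    moreover have "A \<inter> P \<noteq> {}" "B \<inter> P \<noteq> {}"
    proof -
      have "tile j \<inter> P \<noteq> {}" "tile l \<inter> P \<noteq> {}" using j l by (auto simp: W_def)
      then show "A \<inter> P \<noteq> {}" "B \<inter> P \<noteq> {}" using jR l unfolding A_def B_def by blast+
    qed
    ultimately obtain x where "x \<in> A" "x \<in> B" using connected_closedD[OF P(1), of A B] by (metis disjoint_iff IntE)
    then obtain e e' where e: "e \<in> R" "x \<in> tile e" "e' \<in> W" "e' \<notin> R" "x \<in> tile e'"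
      unfolding A_def B_def by blast
    have eI: "e \<in> I" "e' \<in> I" "e \<in> W" using e \<open>W \<subseteq> I\<close> \<open>R \<subseteq> W\<close> by auto
    have "e \<noteq> e'" using e by auto
    have x: "x \<in> {\<gamma> e 0, \<gamma> e 1}" "x \<in> {\<gamma> e' 0, \<gamma> e' 1}"
      using tiles_meet[of e e'] tiles_meet[of e' e] e eI \<open>e \<noteq> e'\<close>
      unfolding pathstart_def pathfinish_def by blast+
    obtain S p where p: "S \<subseteq> W" "tile_walk S p" "pathstart p = \<gamma> j 0" "pathfinish p = \<gamma> e 0"
      using e(1) unfolding R_def by blast
    obtain p1 where p1: "tile_walk {e} p1" "pathstart p1 = \<gamma> e 0" "pathfinish p1 = x"
      using tile_walk_single[OF eI(1) insertI1 x(1)] by blast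
    obtain p2 where p2: "tile_walk {e'} p2" "pathstart p2 = x" "pathfinish p2 = \<gamma> e' 0"
      using tile_walk_single[OF eI(2) x(2) insertI1] by blast
    have "tile_walk ({e} \<union> {e'}) (p1 +++ p2)" using tile_walk_join[OF p1(1) p2(1)] p1 p2 by simp
    then have "tile_walk (S \<union> ({e} \<union> {e'})) (p +++ (p1 +++ p2))"
      by (rule tile_walk_join[OF p(2)]) (simp add: p p1)
    moreover have "S \<union> ({e} \<union> {e'}) \<subseteq> W" using p(1) e eI by blast
    moreover have "pathstart (p +++ (p1 +++ p2)) = \<gamma> j 0" "pathfinish (p +++ (p1 +++ p2)) = \<gamma> e' 0"
      using p p2 by simp_all
    ultimately have "e' \<in> R" unfolding R_def using e(3) by blast
    then show False using e by simp
  qed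
  then have "k \<in> R" using jW by blast
  then show thesis using that unfolding R_def W_def by blast
qed

end

section \<open>The model map\<close>

context arc_tiling
begin

text \<open>
  Here \<open>S i\<close> is the set of tiles that the image of tile \<open>i\<close> runs through.  The middle third carries
  the whole walk, so that the outer thirds, where \<open>\<phi>\<close> is constant, provide room at the vertices.
\<close>

definition markov_map :: "('a \<Rightarrow> 'a) \<Rightarrow> ('i \<Rightarrow> 'i set) \<Rightarrow> bool" where
  "markov_map \<phi> S \<longleftrightarrow> continuous_on G \<phi> \<and>
     (\<forall>i\<in>I. S i \<subseteq> I \<and> \<phi> ` tile i \<subseteq> (\<Union>e\<in>S i. tile e) \<and>
        (\<forall>e\<in>S i. \<exists>a\<in>{1/3..2/3}. \<exists>b\<in>{1/3..2/3}. a \<noteq> b \<and>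
           (\<forall>s\<in>{0..1}. \<phi> (\<gamma> i (a + s * (b - a))) = \<gamma> e s)) \<and>
        (\<forall>t\<in>{0..1/3}. \<phi> (\<gamma> i t) = \<phi> (\<gamma> i 0)) \<and>
        (\<forall>t\<in>{2/3..1}. \<phi> (\<gamma> i t) = \<phi> (\<gamma> i 1)))"

text \<open>
  Every vertex \<open>v\<close> is sent to a vertex of a tile containing \<open>f v\<close>.  The two ends of a tile are then sent
  to vertices of tiles that meet the connected image of the tile under \<open>f\<close>, and a walk along this
  image joins them.
\<close>

lemma markov_map_along:
  assumes f: "continuous_on G f" "f ` G \<subseteq> G"
  obtains \<phi> S where "markov_map \<phi> S"
    "\<And>i. i \<in> I \<Longrightarrow> S i \<subseteq> {k \<in> I. tile k \<inter> f ` tile i \<noteq> {}}"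
proof -
  have "\<exists>k. v \<in> G \<longrightarrow> k \<in> I \<and> f v \<in> tile k" for v
    using f(2) tiles_cover by blast
  then obtain T where T: "\<And>v. v \<in> G \<Longrightarrow> T v \<in> I" "\<And>v. v \<in> G \<Longrightarrow> f v \<in> tile (T v)"
    by metis
  define \<psi> where "\<psi> v = \<gamma> (T v) 0" for v
  have "\<exists>S p. S \<subseteq> {e \<in> I. tile e \<inter> f ` tile i \<noteq> {}} \<and> tile_walk S p \<and>
    pathstart p = \<psi> (\<gamma> i 0) \<and> pathfinish p = \<psi> (\<gamma> i 1)" if i: "i \<in> I" for i
  proof -
    have conn: "connected (f ` tile i)"
    proof (rule connected_continuous_image)
      show "continuous_on (tile i) f" using f(1) tile_subset[OF i] by (rule continuous_on_subset)
      show "connected (tile i)" using arc_tile[OF i] by (simp add: arc_def connected_path_image)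
    qed
    have sub: "f ` tile i \<subseteq> G" using f(2) tile_subset[OF i] by blast
    have v: "\<gamma> i 0 \<in> tile i" "\<gamma> i 1 \<in> tile i" by (auto intro: in_tile)
    then have vG: "\<gamma> i 0 \<in> G" "\<gamma> i 1 \<in> G" using tile_subset[OF i] by auto
    have m: "tile (T (\<gamma> i 0)) \<inter> f ` tile i \<noteq> {}" "tile (T (\<gamma> i 1)) \<inter> f ` tile i \<noteq> {}"
      using T(2)[OF vG(1)] T(2)[OF vG(2)] v by blast+
    obtain S p where "S \<subseteq> {e \<in> I. tile e \<inter> f ` tile i \<noteq> {}}" "tile_walk S p"
      "pathstart p = \<psi> (\<gamma> i 0)" "pathfinish p = \<psi> (\<gamma> i 1)"
      unfolding \<psi>_def
      by (rule tile_walk_along_connected[OF conn sub T(1)[OF vG(1)] m(1) T(1)[OF vG(2)] m(2)])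
    then show ?thesis by blast
  qed
  then have "\<forall>i\<in>I. \<exists>S p. S \<subseteq> {e \<in> I. tile e \<inter> f ` tile i \<noteq> {}} \<and> tile_walk S p \<and>
    pathstart p = \<psi> (\<gamma> i 0) \<and> pathfinish p = \<psi> (\<gamma> i 1)" ..
  from bchoice[OF this] obtain S where "\<forall>i\<in>I. \<exists>p. S i \<subseteq> {e \<in> I. tile e \<inter> f ` tile i \<noteq> {}} \<and>
    tile_walk (S i) p \<and> pathstart p = \<psi> (\<gamma> i 0) \<and> pathfinish p = \<psi> (\<gamma> i 1)" ..
  from bchoice[OF this] obtain p where Sp: "\<forall>i\<in>I. S i \<subseteq> {e \<in> I. tile e \<inter> f ` tile i \<noteq> {}} \<and>
    tile_walk (S i) (p i) \<and> pathstart (p i) = \<psi> (\<gamma> i 0) \<and> pathfinish (p i) = \<psi> (\<gamma> i 1)" ..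
  have S: "\<And>i. i \<in> I \<Longrightarrow> S i \<subseteq> {e \<in> I. tile e \<inter> f ` tile i \<noteq> {}}"
    and walk: "\<And>i. i \<in> I \<Longrightarrow> tile_walk (S i) (p i)"
    and ends: "\<And>i. i \<in> I \<Longrightarrow> p i 0 = \<psi> (\<gamma> i 0)" "\<And>i. i \<in> I \<Longrightarrow> p i 1 = \<psi> (\<gamma> i 1)"
    using Sp unfolding pathstart_def pathfinish_def by blast+
  \<comment> \<open>stays at \<open>0\<close> and at \<open>1\<close> on the outer thirds and maps the middle third linearly onto \<open>{0..1}\<close>\<close>
  define c :: "real \<Rightarrow> real" where "c t = max 0 (min 1 (3 * t - 1))" for t
  have c01: "c t \<in> {0..1}" for t by (auto simp: c_def)
  have "\<forall>i\<in>I. \<exists>q. continuous_on (tile i) q \<and> (\<forall>t\<in>{0..1}. q (\<gamma> i t) = t) \<and>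
      (\<forall>y\<in>tile i. q y \<in> {0..1} \<and> \<gamma> i (q y) = y)"
  proof
    fix i assume "i \<in> I"
    then obtain q where "continuous_on (tile i) q" "\<And>t. t \<in> {0..1} \<Longrightarrow> q (\<gamma> i t) = t"
      "\<And>y. y \<in> tile i \<Longrightarrow> q y \<in> {0..1} \<and> \<gamma> i (q y) = y"
      by (rule tile_inverse) (rule that)
    then show "\<exists>q. continuous_on (tile i) q \<and> (\<forall>t\<in>{0..1}. q (\<gamma> i t) = t) \<and>
      (\<forall>y\<in>tile i. q y \<in> {0..1} \<and> \<gamma> i (q y) = y)" by blast
  qed
  from bchoice[OF this] obtain q where
    q: "\<And>i. i \<in> I \<Longrightarrow> continuous_on (tile i) (q i)"
      "\<And>i t. i \<in> I \<Longrightarrow> t \<in> {0..1} \<Longrightarrow> q i (\<gamma> i t) = t"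
      "\<And>i y. i \<in> I \<Longrightarrow> y \<in> tile i \<Longrightarrow> q i y \<in> {0..1} \<and> \<gamma> i (q i y) = y" by blast
  define ix where "ix y = (SOME i. i \<in> I \<and> y \<in> tile i)" for y
  define \<phi> where "\<phi> y = p (ix y) (c (q (ix y) y))" for y
  have vertex: "p i (c t) = \<psi> (\<gamma> i t)" if "i \<in> I" "t = 0 \<or> t = 1" for i t
    using that ends[OF that(1)] by (auto simp: c_def)
  \<comment> \<open>independence of the chosen tile: tiles overlap in vertices only, where both formulas give \<open>\<psi>\<close>\<close>
  have \<phi>: "\<phi> (\<gamma> i t) = p i (c t)" if i: "i \<in> I" and t: "t \<in> {0..1}" for i t
  proof -
    define k where "k = ix (\<gamma> i t)"
    have "i \<in> I \<and> \<gamma> i t \<in> tile i" using i in_tile[OF t] by blast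
    then have k: "k \<in> I \<and> \<gamma> i t \<in> tile k" unfolding k_def ix_def by (rule someI)
    define u where "u = q k (\<gamma> i t)"
    have u: "u \<in> {0..1}" "\<gamma> k u = \<gamma> i t" using q(3) k by (auto simp: u_def)
    have "p k (c u) = p i (c t)"
    proof (cases "k = i")
      case True
      then show ?thesis using q(2)[OF i t] by (simp add: u_def)
    next
      case False
      have "t = 0 \<or> t = 1"
        using other_tile_endpoint[of k i t] False k i t by blast
      moreover have "u = 0 \<or> u = 1"
        using other_tile_endpoint[of i k u] False k i u in_tile[OF t, of i] by auto
      ultimately show ?thesis using vertex k i u(2) by metis
    qed
    then show ?thesis by (simp add: \<phi>_def k_def u_def)
  qed
  have cont: "continuous_on (tile i) \<phi>" if i: "i \<in> I" for i
  proof -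
    have "continuous_on {0..1} (p i)" using walk[OF i] by (simp add: tile_walk_def path_def)
    moreover have "continuous_on (tile i) (\<lambda>y. c (q i y))"
      unfolding c_def by (intro continuous_intros q(1)[OF i])
    ultimately have "continuous_on (tile i) (\<lambda>y. p i (c (q i y)))"
      by (rule continuous_on_compose2) (use c01 in blast)
    moreover have "p i (c (q i y)) = \<phi> y" if "y \<in> tile i" for y
      using \<phi>[OF i, of "q i y"] q(3)[OF i that] by simp
    ultimately show ?thesis by (rule continuous_on_eq)
  qed
  have "continuous_on G \<phi>"
    unfolding tiles_cover
    by (intro continuous_on_closed_Union finite_tiles cont compact_imp_closed tile_compact)
  moreover have "S i \<subseteq> I" if "i \<in> I" for i using S[OF that] by blast
  moreover have "\<phi> ` tile i \<subseteq> (\<Union>e\<in>S i. tile e)" if i: "i \<in> I" for i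
  proof -
    have "\<phi> ` tile i \<subseteq> path_image (p i)"
    proof
      fix z assume "z \<in> \<phi> ` tile i"
      then obtain t where "t \<in> {0..1}" "z = \<phi> (\<gamma> i t)" by (auto simp: path_image_def)
      then have "z = p i (c t)" using \<phi>[OF i] by simp
      then show "z \<in> path_image (p i)" using c01 unfolding path_image_def by blast
    qed
    then show ?thesis using walk[OF i] unfolding tile_walk_def by blast
  qed
  moreover have "\<exists>a\<in>{1/3..2/3}. \<exists>b\<in>{1/3..2/3}. a \<noteq> b \<and>
           (\<forall>s\<in>{0..1}. \<phi> (\<gamma> i (a + s * (b - a))) = \<gamma> e s)" if i: "i \<in> I" and e: "e \<in> S i" for i e
  proof -
    obtain a b where ab: "a \<in> {0..1}" "b \<in> {0..1}" "a \<noteq> b"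
      and p: "\<And>s. s \<in> {0..1} \<Longrightarrow> p i (a + s * (b - a)) = \<gamma> e s"
      using walk[OF i] e unfolding tile_walk_def traverses_def by blast
    have "\<phi> (\<gamma> i ((1 + a) / 3 + s * ((1 + b) / 3 - (1 + a) / 3))) = \<gamma> e s" if s: "s \<in> {0..1}" for s
    proof -
      define u where "u = a + s * (b - a)"
      have u: "u \<in> {0..1}" unfolding u_def by (rule between_01[OF ab(1,2) s])
      have "(1 + a) / 3 + s * ((1 + b) / 3 - (1 + a) / 3) = (1 + u) / 3"
        by (simp add: u_def field_simps)
      moreover have "c ((1 + u) / 3) = u"
      proof -
        have "3 * ((1 + u) / 3) - 1 = u" by (simp add: field_simps)
        then have "c ((1 + u) / 3) = max 0 (min 1 u)" by (simp only: c_def)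
        then show ?thesis using u by simp
      qed
      moreover have "(1 + u) / 3 \<in> {0..1}" using u by simp
      ultimately show ?thesis using \<phi>[OF i, of "(1 + u) / 3"] p[OF s] unfolding u_def by metis
    qed
    moreover have "(1 + a) / 3 \<in> {1/3..2/3}" "(1 + b) / 3 \<in> {1/3..2/3}" "(1 + a) / 3 \<noteq> (1 + b) / 3"
      using ab by auto
    ultimately show ?thesis by blast
  qed
  moreover have "\<phi> (\<gamma> i t) = \<phi> (\<gamma> i 0)" if "i \<in> I" "t \<in> {0..1/3}" for i t
    using \<phi>[OF that(1), of t] \<phi>[OF that(1), of 0] that(2) by (simp add: c_def)
  moreover have "\<phi> (\<gamma> i t) = \<phi> (\<gamma> i 1)" if "i \<in> I" "t \<in> {2/3..1}" for i t
    using \<phi>[OF that(1), of t] \<phi>[OF that(1), of 1] that(2) by (simp add: c_def)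
  ultimately have "markov_map \<phi> S" unfolding markov_map_def by blast
  then show thesis using S that by blast
qed

end

section \<open>Robustness of the model map\<close>

context arc_tiling
begin

text \<open>
  A point near tile \<open>i\<close> but outside it lies in an outer third of a neighbouring tile, next to a vertex
  of tile \<open>i\<close>.  There \<open>\<phi>\<close> takes the value it has at this vertex.
\<close>

lemma markov_map_near_tile:
  assumes "markov_map \<phi> S"
  obtains \<eta> where "\<eta> > 0"
    "\<And>i y z. \<lbrakk>i \<in> I; y \<in> G; z \<in> tile i; dist y z < \<eta>\<rbrakk> \<Longrightarrow> \<phi> y \<in> (\<Union>e\<in>S i. tile e)"
proof -
  have img: "\<phi> ` tile i \<subseteq> (\<Union>e\<in>S i. tile e)"
    and flat0: "\<And>t. t \<in> {0..1/3} \<Longrightarrow> \<phi> (\<gamma> i t) = \<phi> (\<gamma> i 0)"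
    and flat1: "\<And>t. t \<in> {2/3..1} \<Longrightarrow> \<phi> (\<gamma> i t) = \<phi> (\<gamma> i 1)" if "i \<in> I" for i
    using assms that unfolding markov_map_def by blast+
  have "\<exists>\<eta>>0. \<forall>y\<in>G. \<forall>z\<in>tile i. dist y z < \<eta> \<longrightarrow> \<phi> y \<in> (\<Union>e\<in>S i. tile e)" if i: "i \<in> I" for i
  proof -
    \<comment> \<open>\<open>{a k..b k}\<close> is tile \<open>k\<close> without its outer thirds at the vertices it shares with tile \<open>i\<close>\<close>
    define a :: "'i \<Rightarrow> real" where "a k = (if \<gamma> k 0 \<in> tile i then 1/3 else 0)" for k
    define b :: "'i \<Rightarrow> real" where "b k = (if \<gamma> k 1 \<in> tile i then 2/3 else 1)" for k
    have ab: "{a k..b k} \<subseteq> {0..1}" for k by (auto simp: a_def b_def)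
    define F where "F = (\<Union>k\<in>I - {i}. \<gamma> k ` {a k..b k})"
    have "compact F" unfolding F_def
    proof (intro compact_UN finite_Diff finite_tiles ballI)
      fix k assume "k \<in> I - {i}"
      then show "compact (\<gamma> k ` {a k..b k})"
        by (intro compact_continuous_image continuous_on_subset[OF tile_cont ab]) auto
    qed
    moreover have "tile i \<inter> F = {}"
    proof (rule ccontr)
      assume "tile i \<inter> F \<noteq> {}"
      then obtain k t where kt: "k \<in> I" "i \<noteq> k" "t \<in> {a k..b k}" "\<gamma> k t \<in> tile i"
        unfolding F_def by blast
      then have "t = 0 \<or> t = 1" using other_tile_endpoint[OF i kt(1,2) _ kt(4)] ab by blast
      then show False using kt(3,4) by (auto simp: a_def b_def split: if_splits)
    qed
    ultimately obtain \<eta> where \<eta>: "\<eta> > 0" "\<And>x y. x \<in> tile i \<Longrightarrow> y \<in> F \<Longrightarrow> \<eta> \<le> dist x y"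
      using compact_disjoint_dist[OF tile_compact[OF i]] by metis
    have "\<phi> y \<in> (\<Union>e\<in>S i. tile e)" if y: "y \<in> G" "z \<in> tile i" "dist y z < \<eta>" for y z
    proof (cases "y \<in> tile i")
      case True
      then show ?thesis using img[OF i] by blast
    next
      case False
      obtain k where k: "k \<in> I" "y \<in> tile k" using y(1) tiles_cover by blast
      then obtain t where t: "t \<in> {0..1}" "y = \<gamma> k t" by (auto simp: path_image_def)
      have "k \<noteq> i" using False k by auto
      have "y \<notin> F" using \<eta>(2)[OF y(2), of y] y(3) by (auto simp: dist_commute)
      then have "t \<notin> {a k..b k}" using k t(2) \<open>k \<noteq> i\<close> unfolding F_def by blast
      then consider "t < a k" | "b k < t" by fastforce
      then have "\<exists>v. v \<in> tile i \<and> \<phi> y = \<phi> v"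
      proof cases
        case 1
        then have "\<gamma> k 0 \<in> tile i" "t \<in> {0..1/3}" using t by (auto simp: a_def split: if_splits)
        then show ?thesis using flat0[OF k(1)] t(2) by blast
      next
        case 2
        then have "\<gamma> k 1 \<in> tile i" "t \<in> {2/3..1}" using t by (auto simp: b_def split: if_splits)
        then show ?thesis using flat1[OF k(1)] t(2) by blast
      qed
      then show ?thesis using img[OF i] by auto
    qed
    then show ?thesis using \<eta>(1) by blast
  qed
  then have "\<exists>\<eta>>0. \<forall>i\<in>I. \<forall>y\<in>G. \<forall>z\<in>tile i. dist y z < \<eta> \<longrightarrow> \<phi> y \<in> (\<Union>e\<in>S i. tile e)"
    by (rule finite_uniform_radius[OF finite_tiles]) (assumption, meson order.strict_trans2)
  then show thesis using that by blast
qed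

text \<open>
  Away from its endpoints a tile has positive distance from all other tiles, so nearby points of \<open>G\<close>
  lie in the same tile, and their parameters are close because the inverse of the arc is uniformly
  continuous.
\<close>

lemma tile_middle_robust:
  obtains \<eta> where "\<eta> > 0"
    "\<And>e t y. \<lbrakk>e \<in> I; t \<in> {1/6..5/6}; y \<in> G; dist y (\<gamma> e t) < \<eta>\<rbrakk>
       \<Longrightarrow> \<exists>s\<in>{0..1}. y = \<gamma> e s \<and> \<bar>s - t\<bar> < 1/6"
proof -
  have "\<exists>\<eta>>0. \<forall>t\<in>{1/6..5/6}. \<forall>y\<in>G. dist y (\<gamma> e t) < \<eta> \<longrightarrow> (\<exists>s\<in>{0..1}. y = \<gamma> e s \<and> \<bar>s - t\<bar> < 1/6)"
    if e: "e \<in> I" for e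
  proof -
    obtain q where q: "continuous_on (tile e) q" "\<And>t. t \<in> {0..1} \<Longrightarrow> q (\<gamma> e t) = t"
      "\<And>y. y \<in> tile e \<Longrightarrow> q y \<in> {0..1} \<and> \<gamma> e (q y) = y"
      using tile_inverse[OF e] by metis
    have "uniformly_continuous_on (tile e) q"
      by (rule compact_uniformly_continuous[OF q(1) tile_compact[OF e]])
    moreover have "(1/6::real) > 0" by simp
    ultimately obtain \<eta>1 where \<eta>1: "\<eta>1 > 0"
      "\<And>y z. y \<in> tile e \<Longrightarrow> z \<in> tile e \<Longrightarrow> dist z y < \<eta>1 \<Longrightarrow> dist (q z) (q y) < 1/6"
      unfolding uniformly_continuous_on_def by blast
    define M where "M = \<gamma> e ` {1/6..5/6}"
    define F where "F = (\<Union>k\<in>I - {e}. tile k)"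
    have "compact M" unfolding M_def
      by (intro compact_continuous_image continuous_on_subset[OF tile_cont[OF e]]) auto
    moreover have "compact F" unfolding F_def
      by (intro compact_UN finite_Diff finite_tiles ballI tile_compact) auto
    moreover have "M \<inter> F = {}"
    proof (rule ccontr)
      assume "M \<inter> F \<noteq> {}"
      then obtain k t where "k \<in> I" "k \<noteq> e" "t \<in> {1/6..5/6}" "\<gamma> e t \<in> tile k"
        unfolding M_def F_def by blast
      then show False using other_tile_endpoint[of k e t] e by force
    qed
    ultimately obtain \<eta>2 where \<eta>2: "\<eta>2 > 0" "\<And>x y. x \<in> M \<Longrightarrow> y \<in> F \<Longrightarrow> \<eta>2 \<le> dist x y"
      using compact_disjoint_dist by metis
    have "\<exists>s\<in>{0..1}. y = \<gamma> e s \<and> \<bar>s - t\<bar> < 1/6"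
      if t: "t \<in> {1/6..5/6}" and y: "y \<in> G" "dist y (\<gamma> e t) < min \<eta>1 \<eta>2" for t y
    proof -
      have "\<gamma> e t \<in> M" using t by (auto simp: M_def)
      then have "y \<notin> F" using \<eta>2(2)[of "\<gamma> e t" y] y(2) by (auto simp: dist_commute)
      then have ye: "y \<in> tile e" using y(1) tiles_cover by (auto simp: F_def)
      have t01: "t \<in> {0..1}" using t by simp
      have "dist (q y) (q (\<gamma> e t)) < 1/6" using \<eta>1(2)[OF in_tile[OF t01] ye] y(2) by simp
      then have "\<bar>q y - t\<bar> < 1/6" using q(2)[OF t01] by (simp add: dist_real_def)
      then show ?thesis using q(3)[OF ye] by metis
    qed
    then show ?thesis using \<eta>1(1) \<eta>2(1) by (intro exI[of _ "min \<eta>1 \<eta>2"]) auto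
  qed
  then have "\<exists>\<eta>>0. \<forall>e\<in>I. \<forall>t\<in>{1/6..5/6}. \<forall>y\<in>G.
      dist y (\<gamma> e t) < \<eta> \<longrightarrow> (\<exists>s\<in>{0..1}. y = \<gamma> e s \<and> \<bar>s - t\<bar> < 1/6)"
    by (rule finite_uniform_radius[OF finite_tiles]) (assumption, meson order.strict_trans2)
  then show thesis using that by blast
qed

text \<open>
  The inductive step for realising itineraries.  The curve \<open>t \<mapsto> \<gamma> i (s t)\<close> covers the middle third of
  tile \<open>i\<close>, and \<open>v\<close> is close to its image under \<open>\<phi>\<close>.  On some subinterval this image runs through the
  part \<open>{1/6..5/6}\<close> of tile \<open>e\<close>.  The parameter of \<open>v\<close> differs from it by less than \<open>1/6\<close>, so it still
  covers \<open>{1/3..2/3}\<close>.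
\<close>

lemma robust_crossing:
  fixes s :: "real \<Rightarrow> real"
  assumes markov: "markov_map \<phi> S" and i: "i \<in> I" and e: "e \<in> S i"
    and s: "continuous_on {a..b} s" "s ` {a..b} = {1/3..2/3}"
    and v: "continuous_on {a..b} v" "v ` {a..b} \<subseteq> G"
    and near: "\<And>t. t \<in> {a..b} \<Longrightarrow> dist (v t) (\<phi> (\<gamma> i (s t))) < \<eta>"
    and robust: "\<And>e t y. \<lbrakk>e \<in> I; t \<in> {1/6..5/6}; y \<in> G; dist y (\<gamma> e t) < \<eta>\<rbrakk>
       \<Longrightarrow> \<exists>s\<in>{0..1}. y = \<gamma> e s \<and> \<bar>s - t\<bar> < 1/6"
  obtains a' b' s' where "a' \<le> b'" "{a'..b'} \<subseteq> {a..b}"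
    "continuous_on {a'..b'} s'" "s' ` {a'..b'} = {1/3..2/3}"
    "\<And>t. t \<in> {a'..b'} \<Longrightarrow> v t = \<gamma> e (s' t)"
proof -
  note at_i = bspec[OF conjunct2[OF markov[unfolded markov_map_def]] i]
  have eI: "e \<in> I" using conjunct1[OF at_i] e by (rule subsetD)
  obtain c d where cd: "c \<in> {1/3..2/3}" "d \<in> {1/3..2/3}" "c \<noteq> d"
    and cross: "\<forall>u\<in>{0..1}. \<phi> (\<gamma> i (c + u * (d - c))) = \<gamma> e u"
    using bspec[OF conjunct1[OF conjunct2[OF conjunct2[OF at_i]]] e] by (elim bexE conjE) (rule that)
  \<comment> \<open>parameter in tile \<open>e\<close> of the exact image \<open>\<phi> (\<gamma> i (s t))\<close>\<close>
  define \<theta> where "\<theta> t = (s t - c) / (d - c)" for t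
  obtain tc where tc: "tc \<in> {a..b}" "s tc = c" using cd(1) s(2) by (metis imageE)
  obtain td where td: "td \<in> {a..b}" "s td = d" using cd(2) s(2) by (metis imageE)
  have "continuous_on {a..b} \<theta>" unfolding \<theta>_def
    using cd(3) by (intro continuous_intros s(1)) auto
  then obtain a1 b1 where ab1: "a1 \<le> b1" "{a1..b1} \<subseteq> {a..b}" "\<theta> ` {a1..b1} = {1/6..5/6}"
    by (rule interval_onto_subinterval[of a b \<theta> "1/6" "5/6" tc td]) (use tc td cd(3) in \<open>auto simp: \<theta>_def\<close>)
  have \<theta>16: "\<theta> t \<in> {1/6..5/6}" if "t \<in> {a1..b1}" for t
    using ab1(3) that by blast
  have near_e: "\<exists>u\<in>{0..1}. v t = \<gamma> e u \<and> \<bar>u - \<theta> t\<bar> < 1/6" if t: "t \<in> {a1..b1}" for t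
  proof (rule robust[OF eI \<theta>16[OF t]])
    have "t \<in> {a..b}" using t ab1(2) by blast
    then show "v t \<in> G" using v(2) by blast
    have "\<theta> t \<in> {0..1}" using \<theta>16[OF t] by simp
    moreover have "c + \<theta> t * (d - c) = s t" using cd(3) by (simp add: \<theta>_def)
    ultimately have "\<phi> (\<gamma> i (s t)) = \<gamma> e (\<theta> t)" using bspec[OF cross, of "\<theta> t"] by simp
    then show "dist (v t) (\<gamma> e (\<theta> t)) < \<eta>" using near[OF \<open>t \<in> {a..b}\<close>] by simp
  qed
  obtain q where q: "continuous_on (tile e) q" "\<And>t. t \<in> {0..1} \<Longrightarrow> q (\<gamma> e t) = t"
      "\<And>y. y \<in> tile e \<Longrightarrow> q y \<in> {0..1} \<and> \<gamma> e (q y) = y"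
    using tile_inverse[OF eI] by metis
  define s' where "s' t = q (v t)" for t
  have vt: "v t \<in> tile e" if "t \<in> {a1..b1}" for t
    using near_e[OF that] in_tile by auto
  have s'_near: "\<bar>s' t - \<theta> t\<bar> < 1/6" if "t \<in> {a1..b1}" for t
    using near_e[OF that] q(2) by (auto simp: s'_def)
  have "continuous_on {a1..b1} s'" unfolding s'_def
  proof (rule continuous_on_compose2[OF q(1)])
    show "continuous_on {a1..b1} v" using v(1) ab1(2) by (rule continuous_on_subset)
  qed (use vt in blast)
  moreover obtain u1 where u1: "u1 \<in> {a1..b1}" "\<theta> u1 = 1/6"
  proof -
    have "1/6 \<in> \<theta> ` {a1..b1}" unfolding ab1(3) by simp
    then show thesis using that by force
  qed
  moreover obtain u2 where u2: "u2 \<in> {a1..b1}" "\<theta> u2 = 5/6"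
  proof -
    have "5/6 \<in> \<theta> ` {a1..b1}" unfolding ab1(3) by simp
    then show thesis using that by force
  qed
  moreover have "s' u1 \<le> 1/3" "2/3 \<le> s' u2"
    using s'_near[OF u1(1)] s'_near[OF u2(1)] unfolding u1(2) u2(2) abs_less_iff by linarith+
  ultimately obtain a' b' where ab': "a' \<le> b'" "{a'..b'} \<subseteq> {a1..b1}" "s' ` {a'..b'} = {1/3..2/3}"
    using interval_onto_subinterval[of a1 b1 s' "1/3" "2/3" u1 u2] by auto
  show thesis
  proof (rule that[OF ab'(1) _ _ ab'(3)])
    show "{a'..b'} \<subseteq> {a..b}" using ab' ab1 by blast
    show "continuous_on {a'..b'} s'"
      using \<open>continuous_on {a1..b1} s'\<close> ab'(2) by (rule continuous_on_subset)
    show "v t = \<gamma> e (s' t)" if "t \<in> {a'..b'}" for t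
    proof -
      have "v t \<in> tile e" using vt ab'(2) that by blast
      then show ?thesis using q(3) by (simp add: s'_def)
    qed
  qed
qed

end

section \<open>Shadowing near the model map\<close>

context arc_tiling
begin

text \<open>
  One number \<open>\<eta>\<close> bounds both the distance of \<open>F\<close> from \<open>\<phi> \<circ> r\<close> and the jumps of the pseudo-orbit: each
  contributes less than half of the tolerance of the two robustness lemmas.  The pseudo-orbit and the
  orbit of \<open>z\<close> have retractions in, or near, the same tile at every time.
\<close>

lemma markov_map_shadowing:
  assumes markov: "markov_map \<phi> S" and X: "compact X" and ret: "retraction X G r"
    and h: "h > 0" and small: "\<And>i x y. \<lbrakk>i \<in> I; x \<in> tile i; y \<in> tile i\<rbrakk> \<Longrightarrow> dist x y < h"
  obtains \<eta> where "\<eta> > 0"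
    "\<forall>F x. continuous_on X F \<and> F ` X \<subseteq> X \<and> (\<forall>u\<in>X. dist (F u) (\<phi> (r u)) < \<eta>) \<and>
       pseudo_orbit X F \<eta> x
      \<longrightarrow> (\<exists>z\<in>X. \<forall>n. (F ^^ n) z \<in> X \<and> dist (r (x n)) (r ((F ^^ n) z)) < 2 * h)"
proof -
  have GX: "G \<subseteq> X" and rcont: "continuous_on X r" and rG: "\<And>u. u \<in> X \<Longrightarrow> r u \<in> G"
    and rid: "\<And>u. u \<in> G \<Longrightarrow> r u = u"
    using ret unfolding retraction_def by auto
  have \<phi>tile: "\<phi> ` tile i \<subseteq> (\<Union>e\<in>S i. tile e)" and SI: "S i \<subseteq> I" if "i \<in> I" for i
    using bspec[OF conjunct2[OF markov[unfolded markov_map_def]] that] by blast+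
  have \<phi>G: "\<phi> y \<in> G" if y: "y \<in> G" for y
  proof -
    obtain i where "i \<in> I" "y \<in> tile i" using y tiles_cover by blast
    then obtain e where "e \<in> I" "\<phi> y \<in> tile e" using \<phi>tile[of i] SI[of i] by blast
    then show ?thesis using tile_subset by blast
  qed
  obtain \<eta>1 where \<eta>1: "\<eta>1 > 0"
    "\<And>i y z. \<lbrakk>i \<in> I; y \<in> G; z \<in> tile i; dist y z < \<eta>1\<rbrakk> \<Longrightarrow> \<phi> y \<in> (\<Union>e\<in>S i. tile e)"
    by (rule markov_map_near_tile[OF markov]) (rule that)
  obtain \<eta>2 where \<eta>2: "\<eta>2 > 0"
    "\<And>e t y. \<lbrakk>e \<in> I; t \<in> {1/6..5/6}; y \<in> G; dist y (\<gamma> e t) < \<eta>2\<rbrakk>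
       \<Longrightarrow> \<exists>s\<in>{0..1}. y = \<gamma> e s \<and> \<bar>s - t\<bar> < 1/6"
    by (rule tile_middle_robust) (rule that)
  define \<eta>0 where "\<eta>0 = min h (min \<eta>1 \<eta>2)"
  have \<eta>0: "\<eta>0 > 0" "\<eta>0 \<le> h" "\<eta>0 \<le> \<eta>1" "\<eta>0 \<le> \<eta>2" using \<eta>1(1) \<eta>2(1) h by (auto simp: \<eta>0_def)
  have "uniformly_continuous_on X r" by (rule compact_uniformly_continuous[OF rcont X])
  moreover have "\<eta>0 / 2 > 0" using \<eta>0(1) by simp
  ultimately obtain \<eta> where \<eta>: "\<eta> > 0"
    "\<And>u v. u \<in> X \<Longrightarrow> v \<in> X \<Longrightarrow> dist v u < \<eta> \<Longrightarrow> dist (r v) (r u) < \<eta>0 / 2"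
    unfolding uniformly_continuous_on_def by blast
  show thesis
  proof (rule that[OF \<eta>(1)], intro allI impI, elim conjE)
    fix F x
    assume Fcont: "continuous_on X F" and FX: "F ` X \<subseteq> X"
      and near: "\<forall>u\<in>X. dist (F u) (\<phi> (r u)) < \<eta>" and x: "pseudo_orbit X F \<eta> x"
    have xX: "x n \<in> X" and xstep: "dist (x (Suc n)) (F (x n)) < \<eta>" for n
      using x by (auto simp: pseudo_orbit_def)
    have rF: "dist (r (F u)) (\<phi> (r u)) < \<eta>0 / 2" if u: "u \<in> X" for u
    proof -
      have "\<phi> (r u) \<in> G" using \<phi>G rG u by blast
      then show ?thesis
        using \<eta>(2)[OF _ _ bspec[OF near u]] rid GX FX u by auto
    qed
    have rx: "dist (r (x (Suc n))) (\<phi> (r (x n))) < \<eta>0" for n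
    proof -
      have "dist (r (x (Suc n))) (r (F (x n))) < \<eta>0 / 2"
        using \<eta>(2)[OF _ xX xstep] FX xX by blast
      then show ?thesis
        using rF[OF xX[of n]] dist_triangle_half_r[of "r (F (x n))"] by (simp add: dist_commute)
    qed
    \<comment> \<open>the itinerary of tiles followed by the pseudo-orbit\<close>
    have "\<exists>e. \<forall>n. (e n \<in> I \<and> (\<exists>z\<in>tile (e n). dist (r (x n)) z < \<eta>0)) \<and> e (Suc n) \<in> S (e n)"
    proof (rule dependent_nat_choice)
      obtain i where i: "i \<in> I" "r (x 0) \<in> tile i" using rG[OF xX] tiles_cover by blast
      then have "dist (r (x 0)) (r (x 0)) < \<eta>0" using \<eta>0 by simp
      then show "\<exists>i. i \<in> I \<and> (\<exists>z\<in>tile i. dist (r (x 0)) z < \<eta>0)" using i by blast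
    next
      fix i n
      assume i: "i \<in> I \<and> (\<exists>z\<in>tile i. dist (r (x n)) z < \<eta>0)"
      then obtain z where z: "z \<in> tile i" "dist (r (x n)) z < \<eta>0" by blast
      then have "\<phi> (r (x n)) \<in> (\<Union>e\<in>S i. tile e)"
        using \<eta>1(2)[of i "r (x n)" z] \<eta>0 i rG[OF xX] by simp
      then obtain e where e: "e \<in> S i" "\<phi> (r (x n)) \<in> tile e" by blast
      then show "\<exists>j. (j \<in> I \<and> (\<exists>z\<in>tile j. dist (r (x (Suc n))) z < \<eta>0)) \<and> j \<in> S i"
        using SI[of i] i rx[of n] by blast
    qed
    then obtain e where eI: "\<And>n. e n \<in> I" and enear: "\<And>n. \<exists>z\<in>tile (e n). dist (r (x n)) z < \<eta>0"
      and eS: "\<And>n. e (Suc n) \<in> S (e n)" by blast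
    define w where "w n t = (F ^^ n) (\<gamma> (e 0) t)" for n t
    have w: "continuous_on {0..1} (w n) \<and> w n ` {0..1} \<subseteq> X" for n
    proof (induction n)
      case 0
      have "\<gamma> (e 0) ` {0..1} \<subseteq> X" using tile_subset[OF eI, of 0] GX by (auto simp: path_image_def)
      then show ?case using tile_cont[OF eI, of 0] by (simp add: w_def)
    next
      case (Suc n)
      have "w (Suc n) = (\<lambda>t. F (w n t))" by (auto simp: w_def)
      moreover have "continuous_on {0..1} (\<lambda>t. F (w n t))"
        using Suc by (intro continuous_on_compose2[OF Fcont]) auto
      moreover have "(\<lambda>t. F (w n t)) ` {0..1} \<subseteq> X" using Suc FX by blast
      ultimately show ?case by simp
    qed
    \<comment> \<open>\<open>J\<close> is an interval of starting parameters on tile \<open>e 0\<close> whose \<open>n\<close>-th image retracts onto the middle third of tile \<open>e n\<close>\<close>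
    define good where "good n J \<longleftrightarrow> fst J \<le> snd J \<and> {fst J..snd J} \<subseteq> {0..1} \<and>
      (\<exists>s. continuous_on {fst J..snd J} s \<and> s ` {fst J..snd J} = {1/3..2/3} \<and>
         (\<forall>t\<in>{fst J..snd J}. r (w n t) = \<gamma> (e n) (s t)))" for n and J :: "real \<times> real"
    have "\<exists>J. \<forall>n. good n (J n) \<and> {fst (J (Suc n))..snd (J (Suc n))} \<subseteq> {fst (J n)..snd (J n)}"
    proof (rule dependent_nat_choice)
      have "r (w 0 t) = \<gamma> (e 0) t" if "t \<in> {1/3..2/3}" for t
      proof -
        have "t \<in> {0..1}" using that by simp
        then have "\<gamma> (e 0) t \<in> G" using in_tile tile_subset[OF eI] by blast
        then show ?thesis by (simp add: w_def rid)
      qed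
      then have "good 0 (1/3, 2/3)" unfolding good_def
        by (simp, intro exI[of _ "\<lambda>t. t"]) auto
      then show "\<exists>J. good 0 J" ..
    next
      fix J n
      assume "good n J"
      then obtain s where ab: "{fst J..snd J} \<subseteq> {0..1}"
        and s: "continuous_on {fst J..snd J} s" "s ` {fst J..snd J} = {1/3..2/3}"
        and track: "\<And>t. t \<in> {fst J..snd J} \<Longrightarrow> r (w n t) = \<gamma> (e n) (s t)"
        unfolding good_def by blast
      have wX: "w m t \<in> X" if "t \<in> {fst J..snd J}" for m t
        using w[of m] ab that by blast
      have vcont: "continuous_on {fst J..snd J} (\<lambda>t. r (w (Suc n) t))"
      proof (rule continuous_on_compose2[OF rcont])
        show "continuous_on {fst J..snd J} (w (Suc n))"
          using w[of "Suc n"] ab by (blast intro: continuous_on_subset)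
      qed (use wX in blast)
      have vG: "(\<lambda>t. r (w (Suc n) t)) ` {fst J..snd J} \<subseteq> G" using wX rG by blast
      have vnear: "dist (r (w (Suc n) t)) (\<phi> (\<gamma> (e n) (s t))) < \<eta>2" if t: "t \<in> {fst J..snd J}" for t
        using rF[OF wX[OF t, of n]] track[OF t] \<eta>0 by (simp add: w_def)
      obtain a' b' s' where ab': "a' \<le> b'" "{a'..b'} \<subseteq> {fst J..snd J}"
        "continuous_on {a'..b'} s'" "s' ` {a'..b'} = {1/3..2/3}"
        "\<And>t. t \<in> {a'..b'} \<Longrightarrow> r (w (Suc n) t) = \<gamma> (e (Suc n)) (s' t)"
        by (rule robust_crossing[OF markov eI eS s vcont vG vnear \<eta>2(2)]) (assumption+, rule that)
      then have "good (Suc n) (a', b')" using ab unfolding good_def by auto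
      then show "\<exists>J'. good (Suc n) J' \<and> {fst J'..snd J'} \<subseteq> {fst J..snd J}"
        using ab'(2) by (intro exI[of _ "(a', b')"]) simp
    qed
    then obtain J where J: "\<And>n. good n (J n)"
      "\<And>n. {fst (J (Suc n))..snd (J (Suc n))} \<subseteq> {fst (J n)..snd (J n)}" by blast
    have "\<Inter>(range (\<lambda>n. {fst (J n)..snd (J n)})) \<noteq> {}"
    proof (rule compact_nest)
      show "{fst (J n)..snd (J n)} \<noteq> {}" for n using J(1)[of n] by (simp add: good_def)
      show "{fst (J n)..snd (J n)} \<subseteq> {fst (J m)..snd (J m)}" if "m \<le> n" for m n
        using lift_Suc_antimono_le[of "\<lambda>n. {fst (J n)..snd (J n)}", OF J(2) that] .
    qed simp
    then obtain t where t: "\<And>n. t \<in> {fst (J n)..snd (J n)}" by blast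
    define z where "z = \<gamma> (e 0) t"
    have t01: "t \<in> {0..1}" using t[of 0] J(1)[of 0] unfolding good_def by blast
    have orbit: "(F ^^ n) z \<in> X" for n
      using w[of n] t01 unfolding w_def z_def by blast
    have "dist (r (x n)) (r ((F ^^ n) z)) < 2 * h" for n
    proof -
      obtain s where s: "s ` {fst (J n)..snd (J n)} = {1/3..2/3}" "r (w n t) = \<gamma> (e n) (s t)"
        using J(1)[of n] t[of n] unfolding good_def by blast
      have "s t \<in> {1/3..2/3}" using s(1) t[of n] by blast
      then have "s t \<in> {0..1}" by simp
      then have "r ((F ^^ n) z) \<in> tile (e n)" using s(2) in_tile by (simp add: w_def z_def)
      moreover obtain y where "y \<in> tile (e n)" "dist (r (x n)) y < \<eta>0" using enear by blast
      ultimately show ?thesis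
        using small[OF eI, of y n "r ((F ^^ n) z)"] \<eta>0(2)
          dist_triangle[of "r (x n)" "r ((F ^^ n) z)" y] by simp
    qed
    then show "\<exists>z\<in>X. \<forall>n. (F ^^ n) z \<in> X \<and> dist (r (x n)) (r ((F ^^ n) z)) < 2 * h"
      using orbit orbit[of 0] by (intro bexI[of _ z]) auto
  qed
qed

end

section \<open>Dense approximation by robustly shadowing maps\<close>

definition shadows_within :: "'a::metric_space set \<Rightarrow> real \<Rightarrow> ('a \<Rightarrow> 'a) \<Rightarrow> bool" where
  "shadows_within X \<epsilon> F \<longleftrightarrow> (\<exists>\<delta>>0. \<forall>x. pseudo_orbit X F \<delta> x \<longrightarrow>
        (\<exists>z\<in>X. \<forall>i. dist (x i) ((F ^^ i) z) < \<epsilon>))"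

lemma shadows_within_mono:
  assumes "shadows_within X \<epsilon>' F" "\<epsilon>' \<le> \<epsilon>"
  shows "shadows_within X \<epsilon> F"
proof -
  obtain \<delta> where \<delta>: "\<delta> > 0" "\<forall>x. pseudo_orbit X F \<delta> x \<longrightarrow>
      (\<exists>z\<in>X. \<forall>i. dist (x i) ((F ^^ i) z) < \<epsilon>')"
    using assms(1) unfolding shadows_within_def by blast
  have "\<exists>z\<in>X. \<forall>i. dist (x i) ((F ^^ i) z) < \<epsilon>" if x: "pseudo_orbit X F \<delta> x" for x
  proof -
    obtain z where z: "z \<in> X" "\<forall>i. dist (x i) ((F ^^ i) z) < \<epsilon>'" using \<delta>(2) x by blast
    have "dist (x i) ((F ^^ i) z) < \<epsilon>" for i
      using spec[OF z(2), of i] assms(2) by (rule less_le_trans)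
    then show ?thesis using z(1) by blast
  qed
  then show ?thesis using \<delta>(1) unfolding shadows_within_def by blast
qed

text \<open>
  Since \<open>r\<close> is idempotent, \<open>u\<close> and \<open>r u\<close> lie in the same fibre.
\<close>

lemma graphoid_retraction_near_id:
  assumes "is_graphoid X" "\<epsilon> > 0"
  obtains G r where "is_graph G" "G \<subseteq> X" "retraction X G r" "\<And>u. u \<in> X \<Longrightarrow> dist (r u) u < \<epsilon>"
proof -
  obtain G r where G: "is_graph G" "G \<subseteq> X" and r: "retraction X G r"
    and diam: "\<forall>x\<in>G. diameter {y \<in> X. r y = x} < \<epsilon>"
    using assms unfolding is_graphoid_def by blast
  have "dist (r u) u < \<epsilon>" if u: "u \<in> X" for u
  proof -
    have ru: "r u \<in> G" "r (r u) = r u" using r u unfolding retraction_def by auto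
    have "bounded {y \<in> X. r y = r u}"
    proof (rule bounded_subset)
      show "bounded X" using assms(1) by (simp add: is_graphoid_def compact_imp_bounded)
    qed blast
    then have "dist (r u) u \<le> diameter {y \<in> X. r y = r u}"
      using u ru G(2) by (intro diameter_bounded_bound) auto
    then show ?thesis using diam ru(1) by fastforce
  qed
  then show thesis using that G r by blast
qed

text \<open>
  The distance from \<open>\<phi> \<circ> r\<close> to \<open>f\<close> has three sources: \<open>\<phi>\<close> is within two steps of \<open>\<kappa>/4\<close> of \<open>r \<circ> f\<close>, the
  retraction moves \<open>f (r u)\<close> by less than \<open>\<kappa>/4\<close>, and \<open>f (r u)\<close> is \<open>\<kappa>/4\<close>-close to \<open>f u\<close>.  For the
  shadowing, tiles of diameter below \<open>\<epsilon>/4\<close> contribute \<open>2 (\<epsilon>/4)\<close> and passing to the retractions of the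
  two points contributes \<open>\<epsilon>/4\<close> each.
\<close>

lemma robust_shadowing_dense:
  assumes X: "is_graphoid X" and f: "continuous_on X f" "f ` X \<subseteq> X"
    and pos: "\<kappa> > 0" "\<epsilon> > 0"
  obtains g \<eta> where "continuous_on X g" "g ` X \<subseteq> X" "\<And>u. u \<in> X \<Longrightarrow> dist (g u) (f u) < \<kappa>"
    "\<eta> > 0" "\<forall>F. continuous_on X F \<and> F ` X \<subseteq> X \<and> (\<forall>u\<in>X. dist (F u) (g u) < \<eta>)
      \<longrightarrow> shadows_within X \<epsilon> F"
proof -
  have cX: "compact X" using X by (simp add: is_graphoid_def)
  have "uniformly_continuous_on X f" by (rule compact_uniformly_continuous[OF f(1) cX])
  moreover have "\<kappa> / 4 > 0" using pos by simp
  ultimately obtain d where d: "d > 0"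
    "\<And>u v. u \<in> X \<Longrightarrow> v \<in> X \<Longrightarrow> dist v u < d \<Longrightarrow> dist (f v) (f u) < \<kappa> / 4"
    unfolding uniformly_continuous_on_def by blast
  have "min d (min (\<kappa> / 4) (\<epsilon> / 4)) > 0" using d pos by simp
  then obtain G r where G: "is_graph G" "G \<subseteq> X" and ret: "retraction X G r"
    and close: "\<And>u. u \<in> X \<Longrightarrow> dist (r u) u < min d (min (\<kappa> / 4) (\<epsilon> / 4))"
    by (rule graphoid_retraction_near_id[OF X]) (rule that)
  have rcont: "continuous_on X r" and rG: "\<And>u. u \<in> X \<Longrightarrow> r u \<in> G"
    using ret unfolding retraction_def by auto
  define f0 where "f0 u = r (f u)" for u
  have f0cont: "continuous_on G f0" unfolding f0_def
    using f G(2) by (intro continuous_on_compose2[OF rcont] continuous_on_subset[OF f(1)]) auto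
  have f0G: "f0 ` G \<subseteq> G" using f G(2) rG by (auto simp: f0_def)
  have "uniformly_continuous_on G f0"
    using f0cont G(1) by (intro compact_uniformly_continuous) (auto simp: is_graph_def)
  with \<open>\<kappa> / 4 > 0\<close> obtain d' where d': "d' > 0"
    "\<And>u v. u \<in> G \<Longrightarrow> v \<in> G \<Longrightarrow> dist v u < d' \<Longrightarrow> dist (f0 v) (f0 u) < \<kappa> / 4"
    unfolding uniformly_continuous_on_def by blast
  define h where "h = min d' (min (\<kappa> / 4) (\<epsilon> / 4))"
  have h: "h > 0" "h \<le> d'" "h \<le> \<kappa> / 4" "h \<le> \<epsilon> / 4" using d' pos by (auto simp: h_def)
  obtain I :: "(nat \<times> nat) set" and \<gamma> where tiling: "arc_tiling I \<gamma> G"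
    and small: "\<And>i x y. \<lbrakk>i \<in> I; x \<in> path_image (\<gamma> i); y \<in> path_image (\<gamma> i)\<rbrakk> \<Longrightarrow> dist x y < h"
    by (rule graph_fine_tiling[OF G(1) h(1)]) (rule that)
  interpret arc_tiling I \<gamma> G by (rule tiling)
  obtain \<phi> S where markov: "markov_map \<phi> S"
    and along: "\<And>i. i \<in> I \<Longrightarrow> S i \<subseteq> {k \<in> I. tile k \<inter> f0 ` tile i \<noteq> {}}"
    by (rule markov_map_along[OF f0cont f0G]) (rule that)
  have \<phi>tile: "\<phi> ` tile i \<subseteq> (\<Union>e\<in>S i. tile e)" if "i \<in> I" for i
    using bspec[OF conjunct2[OF markov[unfolded markov_map_def]] that] by blast
  have \<phi>cont: "continuous_on G \<phi>" using markov unfolding markov_map_def by (rule conjunct1)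
  have \<phi>: "\<phi> y \<in> G \<and> dist (\<phi> y) (f0 y) < \<kappa> / 2" if y: "y \<in> G" for y
  proof -
    obtain i where i: "i \<in> I" "y \<in> tile i" using y tiles_cover by blast
    then obtain e where e: "e \<in> S i" "\<phi> y \<in> tile e" using \<phi>tile by blast
    then obtain y' where y': "e \<in> I" "y' \<in> tile i" "f0 y' \<in> tile e" using along[OF i(1)] by blast
    have "y' \<in> G" using y' i tile_subset by blast
    have "dist (\<phi> y) (f0 y') < \<kappa> / 4" using small[OF y'(1) e(2) y'(3)] h by simp
    moreover have "dist (f0 y') (f0 y) < \<kappa> / 4"
      using d'(2)[OF y \<open>y' \<in> G\<close>] small[OF i(1) y'(2) i(2)] h by simp
    ultimately have "dist (\<phi> y) (f0 y) < \<kappa> / 2"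
      using dist_triangle[of "\<phi> y" "f0 y" "f0 y'"] by simp
    then show ?thesis using e(2) tile_subset[OF y'(1)] by blast
  qed
  obtain \<eta> where \<eta>: "\<eta> > 0"
    "\<forall>F x. continuous_on X F \<and> F ` X \<subseteq> X \<and> (\<forall>u\<in>X. dist (F u) (\<phi> (r u)) < \<eta>) \<and>
       pseudo_orbit X F \<eta> x
      \<longrightarrow> (\<exists>z\<in>X. \<forall>n. (F ^^ n) z \<in> X \<and> dist (r (x n)) (r ((F ^^ n) z)) < 2 * h)"
    by (rule markov_map_shadowing[OF markov cX ret h(1)]) (erule (2) small, rule that)
  show thesis
  proof (rule that[of "\<lambda>u. \<phi> (r u)", OF _ _ _ \<eta>(1)])
    show "continuous_on X (\<lambda>u. \<phi> (r u))"
      using rG by (intro continuous_on_compose2[OF \<phi>cont rcont]) auto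
    show "(\<lambda>u. \<phi> (r u)) ` X \<subseteq> X" using \<phi> rG G(2) by blast
    show "dist (\<phi> (r u)) (f u) < \<kappa>" if u: "u \<in> X" for u
    proof -
      have "r u \<in> X" "f (r u) \<in> X" using rG[OF u] G(2) f(2) by auto
      then have "dist (f0 (r u)) (f (r u)) < \<kappa> / 4" "dist (f (r u)) (f u) < \<kappa> / 4"
        using close[of "f (r u)"] d(2)[OF u] close[OF u] by (auto simp: f0_def)
      moreover have "dist (\<phi> (r u)) (f0 (r u)) < \<kappa> / 2" using \<phi> rG[OF u] by blast
      ultimately show ?thesis
        using dist_triangle[of "\<phi> (r u)" "f u" "f0 (r u)"] dist_triangle[of "f0 (r u)" "f u" "f (r u)"]
        by simp
    qed
    show "\<forall>F. continuous_on X F \<and> F ` X \<subseteq> X \<and> (\<forall>u\<in>X. dist (F u) (\<phi> (r u)) < \<eta>)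
      \<longrightarrow> shadows_within X \<epsilon> F"
    proof (intro allI impI)
      fix F assume F: "continuous_on X F \<and> F ` X \<subseteq> X \<and> (\<forall>u\<in>X. dist (F u) (\<phi> (r u)) < \<eta>)"
      have "\<exists>z\<in>X. \<forall>n. dist (x n) ((F ^^ n) z) < \<epsilon>" if x: "pseudo_orbit X F \<eta> x" for x
      proof -
        obtain z where z: "z \<in> X" "\<And>n. (F ^^ n) z \<in> X" "\<And>n. dist (r (x n)) (r ((F ^^ n) z)) < 2 * h"
        proof -
          have "\<exists>z\<in>X. \<forall>n. (F ^^ n) z \<in> X \<and> dist (r (x n)) (r ((F ^^ n) z)) < 2 * h"
            by (rule mp[OF spec[OF spec[OF \<eta>(2)]]]) (use F x in simp)
          then show thesis using that by blast
        qed
        have "dist (x n) ((F ^^ n) z) < \<epsilon>" for n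
        proof -
          have "x n \<in> X" using x by (simp add: pseudo_orbit_def)
          then have "dist (x n) (r (x n)) < \<epsilon> / 4" "dist (r ((F ^^ n) z)) ((F ^^ n) z) < \<epsilon> / 4"
            using close[of "x n"] close[OF z(2)[of n]] by (auto simp: dist_commute)
          then show ?thesis
            using z(3)[of n] h(4) dist_triangle[of "x n" "(F ^^ n) z" "r (x n)"]
              dist_triangle[of "r (x n)" "(F ^^ n) z" "r ((F ^^ n) z)"] by simp
        qed
        then show ?thesis using z(1) by blast
      qed
      then show "shadows_within X \<epsilon> F" unfolding shadows_within_def using \<eta>(1) by blast
    qed
  qed
qed

section \<open>The space of continuous self-maps\<close>

lemma mspace_cmaps:
  assumes "compact X"
  shows "f \<in> mspace (cmaps X) \<longleftrightarrow> f ` X \<subseteq> X \<and> f \<in> extensional X \<and> continuous_on X f"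
proof -
  have "compactin (top_of_set X) (topspace (top_of_set X))"
    using assms by (simp add: compactin_subtopology)
  then show ?thesis
    unfolding cmaps_def compactin_mspace_cfunspace[OF \<open>compactin _ _\<close>]
    by (auto simp: mtopology_of_submetric continuous_map_in_subtopology)
qed

lemma mdist_cmaps_less:
  assumes "compact X" "f \<in> mspace (cmaps X)" "g \<in> mspace (cmaps X)"
    "mdist (cmaps X) f g < a" "u \<in> X"
  shows "dist (f u) (g u) < a"
  using cfunspace_mdist_lt[of "top_of_set X" f "submetric euclidean_metric X" g a u] assms
  by (simp add: cmaps_def compactin_subtopology)

lemma mdist_cmaps_le:
  assumes "0 \<le> a" "\<And>u. u \<in> X \<Longrightarrow> dist (f u) (g u) \<le> a"
  shows "mdist (cmaps X) f g \<le> a"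
  unfolding cmaps_def using assms by (intro mdist_cfunspace_le) auto

lemma mcomplete_cmaps:
  assumes "compact X"
  shows "mcomplete_of (cmaps X)"
proof -
  interpret Submetric UNIV dist X by unfold_locales auto
  have "compact_space sub.mtopology"
    using assms mtopology_submetric by (metis compactin_subspace compactin_euclidean_iff mtopology_is_euclidean)
  then have "sub.mcomplete" by (rule sub.compact_space_imp_mcomplete)
  then have "mcomplete_of (cfunspace (top_of_set X) sub.Self)" by (rule sub.mcomplete_cfunspace)
  moreover have "sub.Self = submetric euclidean_metric X"
    by (simp add: sub.Self_def submetric_def)
  ultimately show ?thesis by (simp add: cmaps_def)
qed

theorem theorem3p5:
  fixes X :: "'a::metric_space set"
  assumes "is_graphite X"
  shows "\<exists>D. D \<subseteq> shadowing_maps X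
           \<and> gdelta_in (mtopology_of (cmaps X)) D
           \<and> mtopology_of (cmaps X) closure_of D = mspace (cmaps X)"
proof -
  have X: "is_graphoid X" using assms by (simp add: is_graphite_def)
  then have cX: "compact X" by (simp add: is_graphoid_def)
  interpret C: Metric_space "mspace (cmaps X)" "mdist (cmaps X)" by simp
  have top: "mtopology_of (cmaps X) = C.mtopology" by (simp add: mtopology_of_def)
  define U where "U n = \<Union>{V. openin C.mtopology V \<and> (\<forall>F\<in>V. shadows_within X (1 / real (Suc n)) F)}"
    for n :: nat
  have U_open: "openin C.mtopology (U n)" for n
    unfolding U_def by (rule openin_Union) blast
  have U_dense: "C.mtopology closure_of (U n) = mspace (cmaps X)" for n
  proof -
    have "\<exists>g\<in>U n. g \<in> C.mball f \<kappa>" if f: "f \<in> mspace (cmaps X)" and "\<kappa> > 0" for f \<kappa>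
    proof -
      have f': "continuous_on X f" "f ` X \<subseteq> X" using f mspace_cmaps[OF cX] by auto
      have "\<kappa> / 2 > 0" "1 / real (Suc n) > 0" using \<open>\<kappa> > 0\<close> by auto
      then obtain g \<eta> where g: "continuous_on X g" "g ` X \<subseteq> X"
        and gf: "\<And>u. u \<in> X \<Longrightarrow> dist (g u) (f u) < \<kappa> / 2" and \<eta>: "\<eta> > 0"
        and robust: "\<forall>F. continuous_on X F \<and> F ` X \<subseteq> X \<and> (\<forall>u\<in>X. dist (F u) (g u) < \<eta>)
          \<longrightarrow> shadows_within X (1 / real (Suc n)) F"
        by (rule robust_shadowing_dense[OF X f']) (rule that)
      \<comment> \<open>the points of the function space are extensional on \<open>X\<close>\<close>
      define g' where "g' = restrict g X"
      have g': "g' \<in> mspace (cmaps X)"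
        unfolding mspace_cmaps[OF cX] using g by (auto simp: g'_def cong: continuous_on_cong)
      have "shadows_within X (1 / real (Suc n)) F" if "F \<in> C.mball g' \<eta>" for F
      proof (rule robust[rule_format], intro conjI ballI)
        have F: "F \<in> mspace (cmaps X)" "mdist (cmaps X) g' F < \<eta>" using that by auto
        then show "continuous_on X F" "F ` X \<subseteq> X" using mspace_cmaps[OF cX, of F] by auto
        show "dist (F u) (g u) < \<eta>" if "u \<in> X" for u
          using mdist_cmaps_less[OF cX g' F that] that by (simp add: g'_def dist_commute)
      qed
      then have "C.mball g' \<eta> \<subseteq> U n" unfolding U_def using C.openin_mball by blast
      then have "g' \<in> U n" using g' \<eta> by auto
      moreover have "mdist (cmaps X) f g' \<le> \<kappa> / 2"
        using gf \<open>\<kappa> > 0\<close> by (intro mdist_cmaps_le) (auto simp: g'_def dist_commute less_imp_le)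
      ultimately show ?thesis using f g' \<open>\<kappa> > 0\<close> by (intro bexI[of _ g']) auto
    qed
    then show ?thesis unfolding C.metric_closure_of by blast
  qed
  have "D \<subseteq> shadowing_maps X" if D: "D = \<Inter>(range U)" for D
  proof
    fix F assume F: "F \<in> D"
    have "F \<in> mspace (cmaps X)"
      using F D openin_subset[OF U_open[of 0]] by auto
    moreover have "shadows_within X \<epsilon> F" if \<epsilon>: "\<epsilon> > 0" for \<epsilon>
    proof -
      obtain n where n: "1 / real (Suc n) < \<epsilon>" using reals_Archimedean[OF \<epsilon>] by (auto simp: inverse_eq_divide)
      have "F \<in> U n" using F D by blast
      then have "shadows_within X (1 / real (Suc n)) F" unfolding U_def by blast
      then show ?thesis by (rule shadows_within_mono) (use n in simp)
    qed
    ultimately show "F \<in> shadowing_maps X"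
      by (auto simp: shadowing_maps_def has_shadowing_def shadows_within_def)
  qed
  moreover have "gdelta_in C.mtopology (\<Inter>(range U))"
    using U_open by (intro gdelta_in_Inter) (auto intro: open_imp_gdelta_in)
  moreover have "C.mtopology closure_of (\<Inter>(range U)) = mspace (cmaps X)"
  proof (rule C.metric_Baire_category)
    show "C.mcomplete" using mcomplete_cmaps[OF cX] by (simp add: mcomplete_of_def)
  qed (use U_open U_dense in auto)
  ultimately show ?thesis unfolding top by blast
qed

end
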